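(* Given cut query access to an $n$-vertex graph $G$ with integer weights in $\{0,1,\ldots,M-1\}$, there is a quantum algorithm making $O(\log^4(n)\log(Mn))$ queries that outputs a spanning forest of $G$ with probability at least $49/50$.
   Context: A weighted graph $G=(V,w)$ has a weight function $w$ on the 2-element subsets of $V$ (here integer-valued in $\{0,\dots,M-1\}$); its edges are the pairs of positive weight. Its adjacency matrix $A$ has $A(u,v)=w(\{u,v\})$ for $u\ne v$ and zero diagonal. A cut query on $z\in\{0,1\}^n$ returns $(1-z)^TAz$. A quantum query algorithm may access the cut-query oracle in superposition in the standard way. A spanning forest of $G$ is a set of edges of $G$ forming a forest whose trees span exactly the connected components of $G$. *)

theory Defs
  imports "Jordan_Normal_Form.Schur_Decomposition"
begin

definition vertex_pairs :: "nat \<Rightarrow> nat set set" where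
  "vertex_pairs n = {e. e \<subseteq> {..<n} \<and> card e = 2}"

definition weight_functions :: "nat \<Rightarrow> nat \<Rightarrow> (nat set \<Rightarrow> int) set" where
  "weight_functions n M = (vertex_pairs n \<rightarrow> {0..<int M})"

definition edges :: "nat \<Rightarrow> (nat set \<Rightarrow> int) \<Rightarrow> nat set set" where
  "edges n w = {e \<in> vertex_pairs n. 0 < w e}"

definition adjacency_matrix :: "nat \<Rightarrow> (nat set \<Rightarrow> int) \<Rightarrow> int mat" where
  "adjacency_matrix n w = mat n n (\<lambda>(u, v). if u = v then 0 else w {u, v})"

definition cut_query :: "nat \<Rightarrow> (nat set \<Rightarrow> int) \<Rightarrow> int vec \<Rightarrow> int" where
  "cut_query n w z = (vec n (\<lambda>_. 1) - z) \<bullet> (adjacency_matrix n w *\<^sub>v z)"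

text \<open>The \<open>forest\<close> and \<open>spanning_tree\<close> of the AFP digraph library refer to directed
  cycles (so that an undirected edge, seen as two opposite arcs, is already a cycle). The
  notions for undirected edge sets are therefore introduced here.\<close>

definition undirected_cycle :: "nat set set \<Rightarrow> nat list \<Rightarrow> bool" where
  "undirected_cycle E vs \<longleftrightarrow> 3 \<le> length vs \<and> distinct vs \<and>
     (\<forall>i < length vs. {vs ! i, vs ! (Suc i mod length vs)} \<in> E)"

definition undirected_forest :: "nat set set \<Rightarrow> bool" where
  "undirected_forest E \<longleftrightarrow> (\<nexists>vs. undirected_cycle E vs)"

definition connected_in :: "nat \<Rightarrow> nat set set \<Rightarrow> (nat \<times> nat) set" where
  "connected_in n E = {(u, v). {u, v} \<in> E}\<^sup>* \<inter> {..<n} \<times> {..<n}"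

definition components :: "nat \<Rightarrow> nat set set \<Rightarrow> nat set set" where
  "components n E = {..<n} // connected_in n E"

text \<open>The trees of a forest \<open>F\<close> are its connected components, isolated vertices included.\<close>

definition spanning_forest :: "nat \<Rightarrow> nat set set \<Rightarrow> nat set set \<Rightarrow> bool" where
  "spanning_forest n E F \<longleftrightarrow> F \<subseteq> E \<and> undirected_forest F \<and> components n F = components n E"

text \<open>A basis state consists of a query \<open>z \<in> {0,1}\<^sup>n\<close>, the content \<open>b\<close> of the answer register
  and the content \<open>x\<close> of a workspace register of arbitrary finite dimension \<open>W\<close>. One oracle
  call maps \<open>(z, b, x)\<close> to \<open>(z, (b + cut(z)) mod K, x)\<close>. All cut values lie in \<open>{0..<K}\<close> for
  \<open>K = n\<^sup>2M\<close> (lemma \<open>cut_query_range\<close>), so no information is lost by the reduction mod \<open>K\<close>.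
  The query \<open>z\<close> is encoded by the number whose binary digits are its entries, and the triple
  by a mixed-radix number below \<open>2\<^sup>n K W\<close>.\<close>

definition query_vec :: "nat \<Rightarrow> nat \<Rightarrow> int vec" where
  "query_vec n q = vec n (\<lambda>v. if bit q v then 1 else 0)"

definition answer_dim :: "nat \<Rightarrow> nat \<Rightarrow> nat" where
  "answer_dim n M = n\<^sup>2 * M"

definition state_dim :: "nat \<Rightarrow> nat \<Rightarrow> nat \<Rightarrow> nat" where
  "state_dim n M W = 2 ^ n * answer_dim n M * W"

definition basis_index :: "nat \<Rightarrow> nat \<Rightarrow> nat \<Rightarrow> nat \<Rightarrow> nat \<Rightarrow> nat" where
  "basis_index K W q b x = (q * K + b) * W + x"

definition cut_oracle :: "nat \<Rightarrow> nat \<Rightarrow> nat \<Rightarrow> (nat set \<Rightarrow> int) \<Rightarrow> complex mat" where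
  "cut_oracle n M W w =
     (let K = answer_dim n M; d = state_dim n M W in
      mat d d (\<lambda>(i, j).
        if \<exists>q < 2 ^ n. \<exists>b < K. \<exists>x < W.
             j = basis_index K W q b x \<and>
             i = basis_index K W q (nat ((int b + cut_query n w (query_vec n q)) mod int K)) x
        then 1 else 0))"

definition unitary_mat :: "nat \<Rightarrow> complex mat \<Rightarrow> bool" where
  "unitary_mat d U \<longleftrightarrow> U \<in> carrier_mat d d \<and>
     mat_adjoint U * U = 1\<^sub>m d \<and> U * mat_adjoint U = 1\<^sub>m d"

text \<open>An algorithm applies \<open>unitaries 0\<close>, then alternates oracle calls with the
  input-independent unitaries \<open>unitaries 1, ..., unitaries num_queries\<close>, measures all registers
  in the computational basis, and post-processes the outcome classically by \<open>result\<close>.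
  Intermediate measurements and classical randomness are deferred to the workspace as usual.\<close>

record 'a quantum_algorithm =
  num_queries :: nat
  workspace_dim :: nat
  unitaries :: "nat \<Rightarrow> complex mat"
  result :: "nat \<Rightarrow> 'a"

definition valid_algorithm :: "nat \<Rightarrow> nat \<Rightarrow> 'a quantum_algorithm \<Rightarrow> bool" where
  "valid_algorithm n M A \<longleftrightarrow> 0 < workspace_dim A \<and>
     (\<forall>t \<le> num_queries A. unitary_mat (state_dim n M (workspace_dim A)) (unitaries A t))"

fun state_after :: "nat \<Rightarrow> nat \<Rightarrow> 'a quantum_algorithm \<Rightarrow> (nat set \<Rightarrow> int) \<Rightarrow> nat \<Rightarrow> complex vec"
where
  "state_after n M A w 0 =
     unitaries A 0 *\<^sub>v unit_vec (state_dim n M (workspace_dim A)) 0"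
| "state_after n M A w (Suc t) =
     unitaries A (Suc t) *\<^sub>v (cut_oracle n M (workspace_dim A) w *\<^sub>v state_after n M A w t)"

definition output_prob ::
  "nat \<Rightarrow> nat \<Rightarrow> 'a quantum_algorithm \<Rightarrow> (nat set \<Rightarrow> int) \<Rightarrow> ('a \<Rightarrow> bool) \<Rightarrow> real" where
  "output_prob n M A w P =
     (\<Sum>i \<in> {i. i < state_dim n M (workspace_dim A) \<and> P (result A i)}.
        (cmod (state_after n M A w (num_queries A) $ i))\<^sup>2)"

lemma cut_query_range:
  assumes "0 < n" "0 < M" "w \<in> weight_functions n M"
  shows "cut_query n w (query_vec n q) \<in> {0..<int (answer_dim n M)}"
proof -
  let ?z = "\<lambda>v. if bit q v then 1 else (0::int)"
  let ?t = "\<lambda>u v. (1 - ?z u) * ((if u = v then 0 else w {u, v}) * ?z v)"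
  have eq: "cut_query n w (query_vec n q) = (\<Sum>u<n. \<Sum>v<n. ?t u v)"
    unfolding cut_query_def query_vec_def adjacency_matrix_def
    by (auto simp: scalar_prod_def sum_distrib_left lessThan_atLeast0 intro!: sum.cong)
  have t: "0 \<le> ?t u v \<and> ?t u v \<le> int M - 1" if "u < n" "v < n" for u v
  proof (cases "u = v")
    case False
    then have "{u, v} \<in> vertex_pairs n"
      using that by (auto simp: vertex_pairs_def)
    then have "w {u, v} \<in> {0..<int M}"
      using assms(3) by (auto simp: weight_functions_def)
    then show ?thesis using False by auto
  qed (use assms in auto)
  have "0 \<le> (\<Sum>u<n. \<Sum>v<n. ?t u v)"
    using t by (intro sum_nonneg) auto
  moreover have "(\<Sum>u<n. \<Sum>v<n. ?t u v) \<le> (\<Sum>u<n. \<Sum>v<n. int M - 1)"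
    using t by (intro sum_mono) auto
  moreover have "(\<Sum>u<n. \<Sum>v<n. int M - 1) < int (answer_dim n M)"
    using assms by (simp add: answer_dim_def power2_eq_square algebra_simps)
  ultimately show ?thesis
    by (simp add: eq)
qed

lemma basis_index_less:
  assumes "q < 2 ^ n" "b < answer_dim n M" "x < W"
  shows "basis_index (answer_dim n M) W q b x < state_dim n M W"
proof -
  have "(q * answer_dim n M + b) * W + x < Suc (q * answer_dim n M + b) * W"
    using assms by simp
  also have "\<dots> \<le> Suc q * answer_dim n M * W"
    using assms by (intro mult_right_mono) auto
  also have "\<dots> \<le> 2 ^ n * answer_dim n M * W"
    using assms by (intro mult_right_mono) auto
  finally show ?thesis
    by (simp add: basis_index_def state_dim_def)
qed

lemma basis_index_inj:
  assumes "basis_index K W q b x = basis_index K W q' b' x'"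
    and "b < K" "x < W" "b' < K" "x' < W"
  shows "q = q' \<and> b = b' \<and> x = x'"
proof -
  have *: "a = a' \<and> c = c'" if "a * N + c = a' * N + c'" "c < N" "c' < N" for a a' c c' N :: nat
    using that by (metis add_right_cancel add.commute div_mult_self3 div_less add_0 mod_mult_self3
        mod_less gr_implies_not0)
  show ?thesis
    using *[of "q * K + b" W x "q' * K + b'" x'] *[of q K b q' b'] assms
    by (auto simp: basis_index_def)
qed

lemma cut_oracle_basis:
  fixes n M W w q
  defines "K \<equiv> answer_dim n M" and "d \<equiv> state_dim n M W"
    and "c \<equiv> cut_query n w (query_vec n q)"
  assumes "q < 2 ^ n" "b < K" "x < W"
  shows "cut_oracle n M W w *\<^sub>v unit_vec d (basis_index K W q b x) =
         unit_vec d (basis_index K W q (nat ((int b + c) mod int K)) x)"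
proof (rule eq_vecI)
  have j: "basis_index K W q b x < d"
    using assms by (simp add: K_def d_def basis_index_less)
  show "dim_vec (cut_oracle n M W w *\<^sub>v unit_vec d (basis_index K W q b x)) =
        dim_vec (unit_vec d (basis_index K W q (nat ((int b + c) mod int K)) x))"
    by (simp add: cut_oracle_def Let_def d_def)
  fix i assume "i < dim_vec (unit_vec d (basis_index K W q (nat ((int b + c) mod int K)) x))"
  then have i: "i < d" by simp
  have "(cut_oracle n M W w *\<^sub>v unit_vec d (basis_index K W q b x)) $ i =
        cut_oracle n M W w $$ (i, basis_index K W q b x)"
    using i j by (simp add: cut_oracle_def Let_def d_def[symmetric])
  also have "\<dots> = (if \<exists>q' < 2 ^ n. \<exists>b' < K. \<exists>x' < W.
             basis_index K W q b x = basis_index K W q' b' x' \<and>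
             i = basis_index K W q' (nat ((int b' + cut_query n w (query_vec n q')) mod int K)) x'
        then 1 else 0)"
    using i j by (simp add: cut_oracle_def Let_def d_def[symmetric] K_def[symmetric])
  also have "\<dots> = (if i = basis_index K W q (nat ((int b + c) mod int K)) x then 1 else 0)"
    using assms(4-6) by (auto simp: c_def dest!: basis_index_inj)
  also have "\<dots> = unit_vec d (basis_index K W q (nat ((int b + c) mod int K)) x) $ i"
    using i by (simp add: unit_vec_def)
  finally show "(cut_oracle n M W w *\<^sub>v unit_vec d (basis_index K W q b x)) $ i =
        unit_vec d (basis_index K W q (nat ((int b + c) mod int K)) x) $ i" .
qed

end

theory Submission
  imports Defs "HOL-Library.Nat_Bijection"
begin


text \<open>The quantum part is one exact test. Fix a vertex set S and put T in uniform
  superposition over all vertex subsets. The cut function is quadratic in T, but in cut(T - S) -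
  cut(T + S), with + for union, the quadratic part cancels: adding a vertex v outside S to T changes
  the difference by exactly 2 d(v), where d(v) is the degree of v into S
  (\<open>cut_value_difference\<close>). Used as a phase with unit angle pi / 2^(j+1), the
  difference is therefore a product of single-qubit phases, and one layer of Hadamard gates reads
  out all v at once: the bit of v is surely 0 if 2^(j+1) divides d(v), and surely 1 if d(v) is 2^j
  modulo 2^(j+1) (\<open>test_state_support\<close>). Since 0 <= d(v) < nM <= 2^J, the levels j < J
  together tell without error which vertices outside S have a neighbour in S. Each level uses two
  cut values, each computed and uncomputed, so a question costs 4 J oracle calls.

  The classical part is a randomized Boruvka scheme. In each round the components of the edges found
  so far are coloured red or blue at random, the red vertices are sampled at rates 2^-i, and a blue
  vertex with exactly one neighbour in a sample learns its name from questions about the halves of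
  the sample given by binary digits (\<open>found_eq_hooks\<close>). Some rate isolates a neighbour
  with probability at least 3/16 (\<open>isolation\<close>), so a component that is not yet final is
  hooked to a red one with probability at least 3/64 (\<open>hook_probability\<close>). Each hooked
  blue component lowers the number of components by one (\<open>card_components_hook\<close>). The
  expected excess thus shrinks by the factor 61/64 per round (\<open>expected_components\<close>),
  and O(log n) rounds suffice by Markov's inequality (\<open>grow_success\<close>).

  With O(log^2 n) questions per round this makes O(log^3 n log(nM)) oracle calls, within the stated
  bound.\<close>

section \<open>Unitary matrices\<close>

lemma mat_adjoint_carrier [simp]: "A \<in> carrier_mat r c \<Longrightarrow> mat_adjoint A \<in> carrier_mat c r"
  by (auto simp: mat_adjoint_def)

lemma mat_adjoint_index:
  assumes "A \<in> carrier_mat r c" "i < c" "j < r"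
  shows "mat_adjoint A $$ (i, j) = conjugate (A $$ (j, i))"
  using assms by (auto simp: mat_adjoint_def mat_of_rows_index)

lemma mat_adjoint_mult:
  fixes A B :: "complex mat"
  assumes "A \<in> carrier_mat r m" "B \<in> carrier_mat m c"
  shows "mat_adjoint (A * B) = mat_adjoint B * mat_adjoint A"
proof (rule eq_matI)
  have AB: "A * B \<in> carrier_mat r c" using assms by simp
  have ad: "mat_adjoint A \<in> carrier_mat m r" "mat_adjoint B \<in> carrier_mat c m"
    using assms by auto
  show "dim_row (mat_adjoint (A * B)) = dim_row (mat_adjoint B * mat_adjoint A)"
    using ad mat_adjoint_carrier[OF AB] by auto
  show "dim_col (mat_adjoint (A * B)) = dim_col (mat_adjoint B * mat_adjoint A)"
    using ad mat_adjoint_carrier[OF AB] by auto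
  fix i j assume "i < dim_row (mat_adjoint B * mat_adjoint A)"
    "j < dim_col (mat_adjoint B * mat_adjoint A)"
  then have ij: "i < c" "j < r" using ad by auto
  have "mat_adjoint (A * B) $$ (i, j) = (\<Sum>k<m. cnj (A $$ (j, k)) * cnj (B $$ (k, i)))"
    using assms ij
    by (simp add: mat_adjoint_index[OF AB] scalar_prod_def lessThan_atLeast0 conjugate_complex_def)
  also have "\<dots> = (mat_adjoint B * mat_adjoint A) $$ (i, j)"
    using assms ij carrier_matD[OF ad(1)] carrier_matD[OF ad(2)]
    by (auto simp: scalar_prod_def lessThan_atLeast0 mat_adjoint_index[OF assms(1)]
        mat_adjoint_index[OF assms(2)] conjugate_complex_def mult.commute intro!: sum.cong)
  finally show "mat_adjoint (A * B) $$ (i, j) = (mat_adjoint B * mat_adjoint A) $$ (i, j)" .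
qed

lemma unitary_mat_mult:
  assumes "unitary_mat d A" "unitary_mat d B"
  shows "unitary_mat d (A * B)"
proof -
  have c: "A \<in> carrier_mat d d" "B \<in> carrier_mat d d"
    "mat_adjoint A \<in> carrier_mat d d" "mat_adjoint B \<in> carrier_mat d d"
    using assms by (auto simp: unitary_mat_def)
  have "mat_adjoint B * mat_adjoint A * (A * B) = mat_adjoint B * (mat_adjoint A * (A * B))"
    using c by (intro assoc_mult_mat[of _ d d _ d _ d]) auto
  also have "mat_adjoint A * (A * B) = mat_adjoint A * A * B"
    using c by (intro assoc_mult_mat[of _ d d _ d _ d, symmetric]) auto
  finally have "mat_adjoint B * mat_adjoint A * (A * B) = mat_adjoint B * (1\<^sub>m d * B)"
    using assms by (simp add: unitary_mat_def)
  then have 1: "mat_adjoint (A * B) * (A * B) = 1\<^sub>m d"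
    using assms(2) c by (simp add: unitary_mat_def mat_adjoint_mult[OF c(1,2)])
  have "mat_adjoint (A * B) \<in> carrier_mat d d" "A * B \<in> carrier_mat d d"
    using c by auto
  then show ?thesis
    using 1 mat_mult_left_right_inverse unfolding unitary_mat_def by blast
qed

lemma unitary_matI:
  assumes "U \<in> carrier_mat d d"
    and "\<And>i j. i < d \<Longrightarrow> j < d \<Longrightarrow> (\<Sum>k<d. cnj (U $$ (k, i)) * U $$ (k, j)) = (if i = j then 1 else 0)"
  shows "unitary_mat d U"
proof -
  have ad: "mat_adjoint U \<in> carrier_mat d d" using assms by simp
  have "mat_adjoint U * U = 1\<^sub>m d"
  proof (rule eq_matI)
    fix i j assume "i < dim_row (1\<^sub>m d :: complex mat)" "j < dim_col (1\<^sub>m d :: complex mat)"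
    then have ij: "i < d" "j < d" by auto
    have "(mat_adjoint U * U) $$ (i, j) = (\<Sum>k<d. cnj (U $$ (k, i)) * U $$ (k, j))"
      using ij carrier_matD[OF assms(1)] carrier_matD[OF ad] by (auto simp: scalar_prod_def lessThan_atLeast0
          mat_adjoint_index[OF assms(1)] conjugate_complex_def intro!: sum.cong)
    then show "(mat_adjoint U * U) $$ (i, j) = 1\<^sub>m d $$ (i, j)"
      using assms(2)[OF ij] ij by simp
  qed (use assms(1) carrier_matD[OF ad] in auto)
  then show ?thesis
    using ad assms mat_mult_left_right_inverse unfolding unitary_mat_def by blast
qed

lemma unitary_mat_one: "unitary_mat d (1\<^sub>m d)"
proof (rule unitary_matI)
  fix i j assume "i < d" "j < d"
  then have "(\<Sum>k<d. cnj (1\<^sub>m d $$ (k, i)) * 1\<^sub>m d $$ (k, j)) =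
      (\<Sum>k<d. if k = i then (if i = j then 1 else 0) else 0 :: complex)"
    by (intro sum.cong) auto
  then show "(\<Sum>k<d. cnj (1\<^sub>m d $$ (k, i)) * 1\<^sub>m d $$ (k, j)) = (if i = j then 1 else 0 :: complex)"
    using \<open>i < d\<close> by (simp add: sum.delta)
qed auto

definition monomial_mat :: "nat \<Rightarrow> (nat \<Rightarrow> nat) \<Rightarrow> (nat \<Rightarrow> complex) \<Rightarrow> complex mat" where
  "monomial_mat d \<pi> \<phi> = mat d d (\<lambda>(i, j). if i = \<pi> j then \<phi> j else 0)"

lemma monomial_mat_carrier [simp]: "monomial_mat d \<pi> \<phi> \<in> carrier_mat d d"
  by (simp add: monomial_mat_def)

lemma unitary_monomial_mat:
  assumes "inj_on \<pi> {..<d}" "\<And>i. i < d \<Longrightarrow> \<pi> i < d" "\<And>i. i < d \<Longrightarrow> cmod (\<phi> i) = 1"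
  shows "unitary_mat d (monomial_mat d \<pi> \<phi>)"
proof (rule unitary_matI)
  fix i j assume ij: "i < d" "j < d"
  have "(\<Sum>k<d. cnj (monomial_mat d \<pi> \<phi> $$ (k, i)) * monomial_mat d \<pi> \<phi> $$ (k, j)) =
    (\<Sum>k<d. if k = \<pi> i then (if \<pi> i = \<pi> j then cnj (\<phi> i) * \<phi> j else 0) else 0)"
    using ij by (intro sum.cong) (auto simp: monomial_mat_def)
  also have "\<dots> = (if \<pi> i = \<pi> j then cnj (\<phi> i) * \<phi> j else 0)"
    using ij assms(2) by (simp add: sum.delta)
  also have "\<dots> = (if i = j then 1 else 0)"
  proof (cases "i = j")
    case True
    then show ?thesis
      using assms(3)[OF ij(1)] complex_norm_square[of "\<phi> i"] by (simp add: mult.commute)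
  next
    case False
    then show ?thesis using assms(1) ij by (auto simp: inj_on_def)
  qed
  finally show "(\<Sum>k<d. cnj (monomial_mat d \<pi> \<phi> $$ (k, i)) * monomial_mat d \<pi> \<phi> $$ (k, j)) =
    (if i = j then 1 else 0)" .
qed simp

section \<open>Hadamard gates as operators on amplitude functions\<close>

section \<open>Flipping bits and Hadamard gates\<close>

lemma bit_flip_bit_nat [simp]: "bit (flip_bit p (x::nat)) q \<longleftrightarrow> (if p = q then \<not> bit x q else bit x q)"
  by (auto simp: bit_flip_bit_iff)

lemma flip_bit_flip_bit [simp]: "flip_bit p (flip_bit p (x::nat)) = x"
  by (rule bit_eqI) auto

lemma flip_bit_inject: "flip_bit p (x::nat) = flip_bit p y \<longleftrightarrow> x = y"
  by (metis flip_bit_flip_bit)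

lemma flip_bit_neq [simp]: "flip_bit p (x::nat) \<noteq> x"
  by (metis bit_flip_bit_nat)

lemma neq_flip_bit [simp]: "x \<noteq> flip_bit p (x::nat)"
  using flip_bit_neq by metis

lemma flip_bit_div: "p < L \<Longrightarrow> flip_bit p (x::nat) div 2 ^ L = x div 2 ^ L"
  by (rule bit_eqI) (auto simp: drop_bit_eq_div[symmetric] bit_drop_bit_eq)

lemma flip_bit_less: 
  assumes "p < L" "(x::nat) < c * 2 ^ L"
  shows "flip_bit p x < c * 2 ^ L"
  using assms by (metis flip_bit_div less_mult_imp_div_less div_less_iff_less_mult zero_less_numeral zero_less_power)

lemma flip_bit_less_power: "p < L \<Longrightarrow> (x::nat) < 2 ^ L \<Longrightarrow> flip_bit p x < 2 ^ L"
  using flip_bit_less[of p L x 1] by simp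

lemma take_bit_flip_bit: "k \<le> p \<Longrightarrow> take_bit k (flip_bit p (x::nat)) = take_bit k x"
  by (rule bit_eqI) (auto simp: bit_take_bit_iff)

lemma flip_bit_commute: "flip_bit p (flip_bit q (x::nat)) = flip_bit q (flip_bit p x)"
  by (rule bit_eqI) auto

text \<open>The gate on qubit \<open>p\<close> acts here on amplitude functions instead of vectors,
  so that the interference arguments need no dimensions.\<close>

definition hadamard_op :: "nat \<Rightarrow> (nat \<Rightarrow> complex) \<Rightarrow> nat \<Rightarrow> complex" where
  "hadamard_op p \<psi> x = ((if bit x p then -1 else 1) * \<psi> x + \<psi> (flip_bit p x)) / sqrt 2"

definition hadamard_mat :: "nat \<Rightarrow> nat \<Rightarrow> complex mat" where
  "hadamard_mat d p = mat d d (\<lambda>(i, j).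
     if i = j then (if bit i p then -1 else 1) / sqrt 2
     else if i = flip_bit p j then 1 / sqrt 2 else 0)"

lemma hadamard_mat_carrier [simp]: "hadamard_mat d p \<in> carrier_mat d d"
  by (simp add: hadamard_mat_def)

lemma sum_two:
  assumes "finite A" "a \<in> A" "b \<in> A" "a \<noteq> b" "\<And>k. k \<in> A \<Longrightarrow> k \<noteq> a \<Longrightarrow> k \<noteq> b \<Longrightarrow> f k = 0"
  shows "sum f A = f a + (f b :: 'a :: comm_monoid_add)"
proof -
  have "sum f A = sum f {a, b}"
    using assms by (intro sum.mono_neutral_right) auto
  then show ?thesis using assms by simp
qed

lemma sqrt_2_square: "complex_of_real (sqrt 2) * complex_of_real (sqrt 2) = 2"
  by (metis of_real_mult of_real_numeral real_sqrt_mult_self abs_numeral)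

text \<open>The dimension is a multiple of \<open>2 ^ L\<close>, so flipping a bit below
  \<open>L\<close> stays in range. A column is supported on an index and its flip, hence each inner
  product has only two terms.\<close>

lemma hadamard_mat_unitary:
  assumes "p < L"
  shows "unitary_mat (c * 2 ^ L) (hadamard_mat (c * 2 ^ L) p)"
proof (rule unitary_matI)
  let ?d = "c * 2 ^ L" and ?H = "hadamard_mat (c * 2 ^ L) p"
  fix i j assume ij: "i < ?d" "j < ?d"
  have f: "flip_bit p i < ?d" by (rule flip_bit_less[OF assms ij(1)])
  have "(\<Sum>k<?d. cnj (?H $$ (k, i)) * ?H $$ (k, j)) =
     cnj (?H $$ (i, i)) * ?H $$ (i, j) + cnj (?H $$ (flip_bit p i, i)) * ?H $$ (flip_bit p i, j)"
    using ij f by (intro sum_two) (auto simp: hadamard_mat_def)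
  also have "\<dots> = (if i = j then 1 else 0)"
    using ij f flip_bit_inject[of p i j]
    by (auto simp: hadamard_mat_def sqrt_2_square simp flip: of_real_mult)
  finally show "(\<Sum>k<?d. cnj (?H $$ (k, i)) * ?H $$ (k, j)) = (if i = j then 1 else 0)" .
qed simp

definition spread :: "nat \<Rightarrow> nat \<Rightarrow> (nat \<Rightarrow> nat) \<Rightarrow> (nat \<Rightarrow> complex) \<Rightarrow> complex vec" where
  "spread d N \<rho> \<psi> = vec d (\<lambda>i. \<Sum>x<N. if i = \<rho> x then \<psi> x else 0)"

definition embed :: "nat \<Rightarrow> nat \<Rightarrow> (nat \<Rightarrow> complex) \<Rightarrow> complex vec" where
  "embed d N \<psi> = vec d (\<lambda>i. if i < N then \<psi> i else 0)"

lemma embed_carrier [simp]: "embed d N \<psi> \<in> carrier_vec d"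
  by (simp add: embed_def)

lemma spread_eq_embed:
  assumes "N \<le> d" "\<And>x. x < N \<Longrightarrow> \<rho> x = x"
  shows "spread d N \<rho> \<psi> = embed d N \<psi>"
proof (rule eq_vecI)
  fix i assume "i < dim_vec (embed d N \<psi>)"
  then have "i < d" by (simp add: embed_def)
  moreover have "(\<Sum>x<N. if i = \<rho> x then \<psi> x else 0) = (\<Sum>x<N. if i = x then \<psi> x else 0)"
    using assms(2) by (intro sum.cong) auto
  ultimately show "spread d N \<rho> \<psi> $ i = embed d N \<psi> $ i"
    by (simp add: spread_def embed_def)
qed (simp add: spread_def embed_def)

lemma spread_cong:
  assumes "\<And>x. x < N \<Longrightarrow> \<rho> x = \<rho>' x" "\<And>x. x < N \<Longrightarrow> \<psi> x = \<psi>' x"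
  shows "spread d N \<rho> \<psi> = spread d N \<rho>' \<psi>'"
  unfolding spread_def
  by (rule arg_cong[where f="vec d"], intro ext sum.cong) (auto simp: assms)

text \<open>Only the columns \<open>\<rho> x\<close> matter. The oracle, the loading of queries and
  the phase gate are all monomial on them.\<close>

lemma mult_spread:
  assumes U: "U \<in> carrier_mat d d"
    and \<rho>: "\<And>x. x < N \<Longrightarrow> \<rho> x < d"
    and col: "\<And>x i. x < N \<Longrightarrow> i < d \<Longrightarrow> U $$ (i, \<rho> x) = (if i = \<rho>' x then a x else 0)"
  shows "U *\<^sub>v spread d N \<rho> \<psi> = spread d N \<rho>' (\<lambda>x. a x * \<psi> x)"
proof (rule eq_vecI)
  fix i assume "i < dim_vec (spread d N \<rho>' (\<lambda>x. a x * \<psi> x))"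
  then have i: "i < d" by (simp add: spread_def)
  have "(U *\<^sub>v spread d N \<rho> \<psi>) $ i = (\<Sum>j<d. U $$ (i, j) * (\<Sum>x<N. if j = \<rho> x then \<psi> x else 0))"
    using i U by (auto simp: spread_def scalar_prod_def lessThan_atLeast0 intro!: sum.cong)
  also have "\<dots> = (\<Sum>j<d. \<Sum>x<N. if j = \<rho> x then U $$ (i, \<rho> x) * \<psi> x else 0)"
    by (auto simp: sum_distrib_left intro!: sum.cong)
  also have "\<dots> = (\<Sum>x<N. \<Sum>j<d. if j = \<rho> x then U $$ (i, \<rho> x) * \<psi> x else 0)"
    by (rule sum.swap)
  also have "\<dots> = (\<Sum>x<N. U $$ (i, \<rho> x) * \<psi> x)"
    using \<rho> by (intro sum.cong) (auto simp: sum.delta)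
  also have "\<dots> = (\<Sum>x<N. if i = \<rho>' x then a x * \<psi> x else 0)"
    using col i by (intro sum.cong) auto
  finally show "(U *\<^sub>v spread d N \<rho> \<psi>) $ i = spread d N \<rho>' (\<lambda>x. a x * \<psi> x) $ i"
    using i by (simp add: spread_def)
qed (use U in \<open>simp add: spread_def\<close>)

lemma hadamard_mat_embed:
  assumes "p < L" "0 < c"
  shows "hadamard_mat (c * 2 ^ L) p *\<^sub>v embed (c * 2 ^ L) (2 ^ L) \<psi> =
    embed (c * 2 ^ L) (2 ^ L) (hadamard_op p \<psi>)"
proof (rule eq_vecI)
  let ?d = "c * 2 ^ L" and ?H = "hadamard_mat (c * 2 ^ L) p"
  have le: "2 ^ L \<le> ?d" using assms by simp
  fix i assume "i < dim_vec (embed ?d (2 ^ L) (hadamard_op p \<psi>))"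
  then have i: "i < ?d" by (simp add: embed_def)
  have f: "flip_bit p i < ?d" by (rule flip_bit_less[OF assms(1) i])
  have fl: "flip_bit p i < 2 ^ L \<longleftrightarrow> i < 2 ^ L"
    using flip_bit_less_power[OF assms(1), of i] flip_bit_less_power[OF assms(1), of "flip_bit p i"] by auto
  let ?v = "\<lambda>i. if i < 2 ^ L then \<psi> i else 0"
  have "(?H *\<^sub>v embed ?d (2 ^ L) \<psi>) $ i = (\<Sum>j<?d. ?H $$ (i, j) * ?v j)"
    using i le by (auto simp: embed_def scalar_prod_def lessThan_atLeast0 hadamard_mat_def intro!: sum.cong)
  also have "\<dots> = ?H $$ (i, i) * ?v i + ?H $$ (i, flip_bit p i) * ?v (flip_bit p i)"
    using i f by (intro sum_two) (auto simp: hadamard_mat_def)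
  also have "\<dots> = (if i < 2 ^ L then hadamard_op p \<psi> i else 0)"
    using i f fl
    by (auto simp: hadamard_mat_def hadamard_op_def add_divide_distrib diff_divide_distrib )
  finally show "(?H *\<^sub>v embed ?d (2 ^ L) \<psi>) $ i = embed ?d (2 ^ L) (hadamard_op p \<psi>) $ i"
    using i le by (simp add: embed_def)
qed (simp add: embed_def hadamard_mat_def)

text \<open>The head of the list acts first, to agree with \<open>fold\<close>.\<close>

fun hadamard_mats :: "nat \<Rightarrow> nat list \<Rightarrow> complex mat" where
  "hadamard_mats d [] = 1\<^sub>m d"
| "hadamard_mats d (p # ps) = hadamard_mats d ps * hadamard_mat d p"

lemma hadamard_mats_unitary:
  "set ps \<subseteq> {..<L} \<Longrightarrow> unitary_mat (c * 2 ^ L) (hadamard_mats (c * 2 ^ L) ps)"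
  by (induction ps) (auto intro: unitary_mat_one unitary_mat_mult hadamard_mat_unitary)

lemma unitary_mat_carrier: "unitary_mat d U \<Longrightarrow> U \<in> carrier_mat d d"
  by (simp add: unitary_mat_def)

lemma hadamard_mats_embed:
  assumes "set ps \<subseteq> {..<L}" "0 < c"
  shows "hadamard_mats (c * 2 ^ L) ps *\<^sub>v embed (c * 2 ^ L) (2 ^ L) \<psi> =
    embed (c * 2 ^ L) (2 ^ L) (fold hadamard_op ps \<psi>)"
  using assms(1)
proof (induction ps arbitrary: \<psi>)
  case Nil
  then show ?case by (auto simp: embed_def)
next
  case (Cons p ps)
  let ?d = "c * 2 ^ L"
  have "hadamard_mats ?d ps \<in> carrier_mat ?d ?d"
    using Cons.prems by (intro unitary_mat_carrier hadamard_mats_unitary) auto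
  then have "hadamard_mats ?d (p # ps) *\<^sub>v embed ?d (2 ^ L) \<psi> =
      hadamard_mats ?d ps *\<^sub>v (hadamard_mat ?d p *\<^sub>v embed ?d (2 ^ L) \<psi>)"
    by (simp add: assoc_mult_mat_vec[OF _ hadamard_mat_carrier] embed_def)
  then show ?case
    using Cons assms(2) by (simp add: hadamard_mat_embed)
qed


section \<open>Phase queries by computing, rotating and uncomputing the cut value\<close>

section \<open>Phase queries\<close>

lemma basis_index_decode:
  assumes "b < K" "x < N"
  shows "basis_index K N q b x div N div K = q" "basis_index K N q b x div N mod K = b"
    "basis_index K N q b x mod N = x"
  using assms by (auto simp: basis_index_def)

definition lift_registers ::
  "nat \<Rightarrow> nat \<Rightarrow> (nat \<Rightarrow> nat \<Rightarrow> nat \<Rightarrow> nat \<times> nat \<times> nat) \<Rightarrow> nat \<Rightarrow> nat" where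
  "lift_registers K N f i =
     (case f (i div N div K) (i div N mod K) (i mod N) of (q, b, x) \<Rightarrow> basis_index K N q b x)"

lemma lift_registers_basis_index:
  "b < K \<Longrightarrow> x < N \<Longrightarrow> lift_registers K N f (basis_index K N q b x) =
     (case f q b x of (q, b, x) \<Rightarrow> basis_index K N q b x)"
  by (simp add: lift_registers_def basis_index_decode)

lemma basis_index_cases:
  assumes "i < state_dim n M N"
  obtains q b x where "q < 2 ^ n" "b < answer_dim n M" "x < N"
    "i = basis_index (answer_dim n M) N q b x"
proof
  let ?K = "answer_dim n M"
  have pos: "0 < N" "0 < ?K" using assms by (auto simp: state_dim_def intro!: Nat.gr0I)
  show "i div N div ?K < 2 ^ n"
    using assms pos by (simp add: state_dim_def less_mult_imp_div_less mult.commute mult.left_commute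
        flip: div_mult2_eq)
  show "i div N mod ?K < ?K" "i mod N < N" using pos by auto
  show "i = basis_index ?K N (i div N div ?K) (i div N mod ?K) (i mod N)"
    unfolding basis_index_def by (simp only: div_mult_mod_eq)
qed

text \<open>XOR with a function of \<open>x\<close> and negation modulo \<open>K\<close> are
  self-inverse, so this one criterion makes both gates permutations of the basis up to
  phases.\<close>

lemma lift_registers_involution:
  assumes f: "\<And>q b x. q < 2 ^ n \<Longrightarrow> b < answer_dim n M \<Longrightarrow> x < N \<Longrightarrow>
    (case f q b x of (q', b', x') \<Rightarrow> q' < 2 ^ n \<and> b' < answer_dim n M \<and> x' < N \<and> f q' b' x' = (q, b, x))"
  shows "inj_on (lift_registers (answer_dim n M) N f) {..<state_dim n M N}"
    and "\<And>i. i < state_dim n M N \<Longrightarrow> lift_registers (answer_dim n M) N f i < state_dim n M N"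
proof -
  let ?g = "lift_registers (answer_dim n M) N f"
  have *: "?g i < state_dim n M N \<and> ?g (?g i) = i" if i: "i < state_dim n M N" for i
  proof -
    obtain q b x where v: "q < 2 ^ n" "b < answer_dim n M" "x < N"
      "i = basis_index (answer_dim n M) N q b x" using basis_index_cases[OF i] .
    obtain q' b' x' where e: "f q b x = (q', b', x')" by (cases "f q b x")
    have "q' < 2 ^ n" "b' < answer_dim n M" "x' < N" "f q' b' x' = (q, b, x)"
      using f[OF v(1-3)] by (auto simp: e)
    then show ?thesis
      by (simp add: v lift_registers_basis_index e basis_index_less)
  qed
  show "inj_on ?g {..<state_dim n M N}"
    by (metis * inj_onI lessThan_iff)
  show "\<And>i. i < state_dim n M N \<Longrightarrow> ?g i < state_dim n M N"
    using * by auto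
qed

text \<open>Loads the query \<open>g x\<close> into the query register; as an XOR it also unloads it
  again.\<close>

definition toggle_mat :: "nat \<Rightarrow> nat \<Rightarrow> nat \<Rightarrow> (nat \<Rightarrow> nat) \<Rightarrow> complex mat" where
  "toggle_mat n M N g = monomial_mat (state_dim n M N)
     (lift_registers (answer_dim n M) N (\<lambda>q b x. (xor q (g x), b, x))) (\<lambda>_. 1)"

text \<open>The negation of the answer register turns the next oracle call into an uncomputation.\<close>

definition phase_mat :: "nat \<Rightarrow> nat \<Rightarrow> nat \<Rightarrow> (nat \<Rightarrow> complex) \<Rightarrow> complex mat" where
  "phase_mat n M N \<phi> = monomial_mat (state_dim n M N)
     (lift_registers (answer_dim n M) N (\<lambda>q b x. (q, (answer_dim n M - b) mod answer_dim n M, x)))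
     (\<lambda>i. \<phi> (i div N mod answer_dim n M))"

lemma xor_less_power:
  assumes "(a::nat) < 2 ^ n" "b < 2 ^ n"
  shows "xor a b < 2 ^ n"
  using assms by (metis take_bit_nat_eq_self_iff take_bit_xor)

lemma negate_mod_involution: "b < K \<Longrightarrow> (K - (K - b) mod K) mod K = (b::nat)"
  by (cases "b = 0") auto

lemma toggle_mat_unitary:
  assumes "\<And>x. g x < 2 ^ n"
  shows "unitary_mat (state_dim n M N) (toggle_mat n M N g)"
  unfolding toggle_mat_def
  by (intro unitary_monomial_mat lift_registers_involution)
    (auto simp: xor_less_power assms xor.assoc)

lemma phase_mat_unitary:
  assumes "\<And>b. cmod (\<phi> b) = 1"
  shows "unitary_mat (state_dim n M N) (phase_mat n M N \<phi>)"
  unfolding phase_mat_def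
  by (intro unitary_monomial_mat lift_registers_involution)
    (auto simp: negate_mod_involution assms)

context
  fixes n M N d K :: nat and q b :: "nat \<Rightarrow> nat"
  defines "d \<equiv> state_dim n M N" and "K \<equiv> answer_dim n M"
  assumes q: "\<And>x. q x < 2 ^ n" and b: "\<And>x. x < N \<Longrightarrow> b x < K"
begin

lemma register_less: "x < N \<Longrightarrow> basis_index K N (q x) (b x) x < d"
  using q b by (simp add: d_def K_def basis_index_less)

lemma toggle_mat_spread:
  "toggle_mat n M N g *\<^sub>v spread d N (\<lambda>x. basis_index K N (q x) (b x) x) \<psi> =
   spread d N (\<lambda>x. basis_index K N (xor (q x) (g x)) (b x) x) \<psi>"
  using mult_spread[of "toggle_mat n M N g" d N "\<lambda>x. basis_index K N (q x) (b x) x"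
      "\<lambda>x. basis_index K N (xor (q x) (g x)) (b x) x" "\<lambda>_. 1" \<psi>] register_less b
  by (simp add: toggle_mat_def monomial_mat_def lift_registers_basis_index flip: d_def K_def)

lemma phase_mat_spread:
  "phase_mat n M N \<phi> *\<^sub>v spread d N (\<lambda>x. basis_index K N (q x) (b x) x) \<psi> =
   spread d N (\<lambda>x. basis_index K N (q x) ((K - b x) mod K) x) (\<lambda>x. \<phi> (b x) * \<psi> x)"
  using mult_spread[of "phase_mat n M N \<phi>" d N "\<lambda>x. basis_index K N (q x) (b x) x"
      "\<lambda>x. basis_index K N (q x) ((K - b x) mod K) x" "\<lambda>x. \<phi> (b x)" \<psi>] register_less b
  by (simp add: phase_mat_def monomial_mat_def lift_registers_basis_index basis_index_decode
      flip: d_def K_def)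

lemma cut_oracle_spread:
  "cut_oracle n M N w *\<^sub>v spread d N (\<lambda>x. basis_index K N (q x) (b x) x) \<psi> =
   spread d N (\<lambda>x. basis_index K N (q x)
     (nat ((int (b x) + cut_query n w (query_vec n (q x))) mod int K)) x) \<psi>"
    (is "_ = spread d N ?\<rho> \<psi>")
proof -
  have c: "cut_oracle n M N w \<in> carrier_mat d d"
    by (simp add: cut_oracle_def Let_def d_def)
  have "cut_oracle n M N w $$ (i, basis_index K N (q x) (b x) x) = (if i = ?\<rho> x then 1 else 0)"
    if "x < N" "i < d" for x i
  proof -
    let ?j = "basis_index K N (q x) (b x) x"
    have "cut_oracle n M N w $$ (i, ?j) = (cut_oracle n M N w *\<^sub>v unit_vec d ?j) $ i"
      using that c register_less[OF that(1)] by (simp add: carrier_matD)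
    also have "\<dots> = unit_vec d (?\<rho> x) $ i"
      using cut_oracle_basis[OF q b[OF that(1), unfolded K_def] that(1), of w]
      by (simp add: d_def K_def)
    finally show ?thesis using that by (simp add: unit_vec_def)
  qed
  then show ?thesis
    using mult_spread[OF c, of N "\<lambda>x. basis_index K N (q x) (b x) x" ?\<rho> "\<lambda>_. 1" \<psi>] register_less by simp
qed

end

text \<open>A phase query costs two oracle calls: load the query, call, rotate and negate the
  answer, call again to clear it, unload, apply Hadamard gates. The unitary with even index
  \<open>2 * t\<close> joins the end of one such block to the loading for the next.\<close>

definition phase_algorithm ::
  "nat \<Rightarrow> nat \<Rightarrow> nat \<Rightarrow> nat \<Rightarrow> (nat \<Rightarrow> nat \<Rightarrow> nat) \<Rightarrow> (nat \<Rightarrow> nat \<Rightarrow> complex) \<Rightarrow> (nat \<Rightarrow> nat list) \<Rightarrow>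
   (nat \<Rightarrow> 'a) \<Rightarrow> 'a quantum_algorithm" where
  "phase_algorithm n M L T g \<phi> ps out =
    (let N = 2 ^ L; d = state_dim n M N in
     \<lparr>num_queries = 2 * T, workspace_dim = N,
      unitaries = (\<lambda>k.
        if k = 0 then toggle_mat n M N (g 0) * hadamard_mats d [0..<L]
        else if odd k then phase_mat n M N (\<phi> (k div 2))
        else toggle_mat n M N (g (k div 2)) *
          (hadamard_mats d (ps (k div 2 - 1)) * toggle_mat n M N (g (k div 2 - 1)))),
      result = out\<rparr>)"

fun evolve ::
  "nat \<Rightarrow> (nat set \<Rightarrow> int) \<Rightarrow> nat \<Rightarrow> (nat \<Rightarrow> nat \<Rightarrow> nat) \<Rightarrow> (nat \<Rightarrow> nat \<Rightarrow> complex) \<Rightarrow> (nat \<Rightarrow> nat list) \<Rightarrow>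
   nat \<Rightarrow> nat \<Rightarrow> complex" where
  "evolve n w L g \<phi> ps 0 = fold hadamard_op [0..<L] (\<lambda>x. if x = 0 then 1 else 0)"
| "evolve n w L g \<phi> ps (Suc t) = fold hadamard_op (ps t)
     (\<lambda>x. \<phi> t (nat (cut_query n w (query_vec n (g t x)))) * evolve n w L g \<phi> ps t x)"

context
  fixes n M L T :: nat and g :: "nat \<Rightarrow> nat \<Rightarrow> nat" and \<phi> :: "nat \<Rightarrow> nat \<Rightarrow> complex"
    and ps :: "nat \<Rightarrow> nat list" and out :: "nat \<Rightarrow> 'a"
  assumes n: "0 < n" and M: "0 < M" and g: "\<And>t x. g t x < 2 ^ n"
    and \<phi>: "\<And>t b. cmod (\<phi> t b) = 1" and ps: "\<And>t. set (ps t) \<subseteq> {..<L}"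
begin

lemma hadamard_mats_state_dim_unitary:
  "set l \<subseteq> {..<L} \<Longrightarrow> unitary_mat (state_dim n M (2 ^ L)) (hadamard_mats (state_dim n M (2 ^ L)) l)"
  unfolding state_dim_def by (rule hadamard_mats_unitary)

lemma phase_algorithm_valid: "valid_algorithm n M (phase_algorithm n M L T g \<phi> ps out)"
proof -
  have "set [0..<L] \<subseteq> {..<L}" by auto
  then show ?thesis
    using g \<phi> unfolding valid_algorithm_def phase_algorithm_def Let_def
    by (auto intro!: unitary_mat_mult toggle_mat_unitary phase_mat_unitary
        hadamard_mats_state_dim_unitary[OF ps] hadamard_mats_state_dim_unitary[of "[0..<L]"])
qed

lemma state_after_phase_algorithm:
  assumes w: "w \<in> weight_functions n M"
  shows "state_after n M (phase_algorithm n M L T g \<phi> ps out) w (2 * t) =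
    spread (state_dim n M (2 ^ L)) (2 ^ L)
      (\<lambda>x. basis_index (answer_dim n M) (2 ^ L) (g t x) 0 x) (evolve n w L g \<phi> ps t)"
proof (induction t)
  let ?N = "2 ^ L" let ?d = "state_dim n M (2 ^ L)" and ?K = "answer_dim n M"
  let ?A = "phase_algorithm n M L T g \<phi> ps out"
  have d: "?d = 2 ^ n * ?K * 2 ^ L" by (simp add: state_dim_def)
  have K: "0 < ?K" using n M by (simp add: answer_dim_def)
  have Nd: "?N \<le> ?d" using K by (simp add: d)
  have embed_hadamard: "hadamard_mats ?d l *\<^sub>v embed ?d ?N \<psi> = embed ?d ?N (fold hadamard_op l \<psi>)"
    if "set l \<subseteq> {..<L}" for l \<psi>
    unfolding d using that K by (intro hadamard_mats_embed) auto
  have zero: "embed ?d ?N \<psi> = spread ?d ?N (\<lambda>x. basis_index ?K ?N 0 0 x) \<psi>" for \<psi>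
    using Nd by (intro spread_eq_embed[symmetric]) (auto simp: basis_index_def)
  have G: "toggle_mat n M ?N (g t) \<in> carrier_mat ?d ?d" for t
    using g by (intro unitary_mat_carrier toggle_mat_unitary)
  have H: "hadamard_mats ?d l \<in> carrier_mat ?d ?d" if "set l \<subseteq> {..<L}" for l
    using that by (intro unitary_mat_carrier hadamard_mats_state_dim_unitary)
  {
    case 0
    have "state_after n M ?A w (2 * 0) =
      (toggle_mat n M ?N (g 0) * hadamard_mats ?d [0..<L]) *\<^sub>v unit_vec ?d 0"
      by (simp add: phase_algorithm_def Let_def)
    also have "unit_vec ?d 0 = embed ?d ?N (\<lambda>x. if x = 0 then 1 else 0)"
      by (rule eq_vecI) (auto simp: embed_def)
    also have "(toggle_mat n M ?N (g 0) * hadamard_mats ?d [0..<L]) *\<^sub>v \<dots> =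
      toggle_mat n M ?N (g 0) *\<^sub>v (hadamard_mats ?d [0..<L] *\<^sub>v \<dots>)"
      by (intro assoc_mult_mat_vec[OF G H]) auto
    also have "hadamard_mats ?d [0..<L] *\<^sub>v embed ?d ?N (\<lambda>x. if x = 0 then 1 else 0) =
      embed ?d ?N (evolve n w L g \<phi> ps 0)"
      by (subst embed_hadamard) auto
    also have "toggle_mat n M ?N (g 0) *\<^sub>v \<dots> = spread ?d ?N (\<lambda>x. basis_index ?K ?N (g 0 x) 0 x)
      (evolve n w L g \<phi> ps 0)"
      unfolding zero using K by (subst toggle_mat_spread) auto
    finally show ?case .
  next
    case (Suc t)
    define c where "c x = nat (cut_query n w (query_vec n (g t x)))" for x
    have c: "cut_query n w (query_vec n (g t x)) = int (c x)" "c x < ?K" for x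
      using cut_query_range[OF n M w, of "g t x"] by (auto simp: c_def)
    let ?\<psi> = "evolve n w L g \<phi> ps t" and ?\<psi>' = "\<lambda>x. \<phi> t (c x) * evolve n w L g \<phi> ps t x"
    have "state_after n M ?A w (2 * Suc t) =
      (toggle_mat n M ?N (g (Suc t)) * (hadamard_mats ?d (ps t) * toggle_mat n M ?N (g t))) *\<^sub>v
      (cut_oracle n M ?N w *\<^sub>v (phase_mat n M ?N (\<phi> t) *\<^sub>v
        (cut_oracle n M ?N w *\<^sub>v state_after n M ?A w (2 * t))))"
      by (simp add: phase_algorithm_def Let_def)
    also have "cut_oracle n M ?N w *\<^sub>v state_after n M ?A w (2 * t) =
      spread ?d ?N (\<lambda>x. basis_index ?K ?N (g t x) (c x) x) ?\<psi>"
      unfolding Suc.IH using K g c by (subst cut_oracle_spread) auto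
    also have "phase_mat n M ?N (\<phi> t) *\<^sub>v \<dots> =
      spread ?d ?N (\<lambda>x. basis_index ?K ?N (g t x) ((?K - c x) mod ?K) x) ?\<psi>'"
      using g c by (subst phase_mat_spread) auto
    also have "cut_oracle n M ?N w *\<^sub>v \<dots> = spread ?d ?N (\<lambda>x. basis_index ?K ?N (g t x)
       (nat ((int ((?K - c x) mod ?K) + cut_query n w (query_vec n (g t x))) mod int ?K)) x) ?\<psi>'"
      using g K by (subst cut_oracle_spread) auto
    \<comment> \<open>The second call adds the cut value to its negative modulo \<open>K\<close>,
      which clears the answer register.\<close>
    also have "\<dots> = spread ?d ?N (\<lambda>x. basis_index ?K ?N (g t x) 0 x) ?\<psi>'"
    proof (intro spread_cong)
      fix x
      have "((?K - c x) mod ?K + c x) mod ?K = 0"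
        using c(2)[of x] by (simp add: mod_add_left_eq)
      then show "basis_index ?K ?N (g t x)
         (nat ((int ((?K - c x) mod ?K) + cut_query n w (query_vec n (g t x))) mod int ?K)) x =
        basis_index ?K ?N (g t x) 0 x"
        unfolding c by (metis nat_int of_nat_add of_nat_mod)
    qed auto
    also have "(toggle_mat n M ?N (g (Suc t)) * (hadamard_mats ?d (ps t) * toggle_mat n M ?N (g t))) *\<^sub>v \<dots> =
      toggle_mat n M ?N (g (Suc t)) *\<^sub>v ((hadamard_mats ?d (ps t) * toggle_mat n M ?N (g t)) *\<^sub>v \<dots>)"
      by (intro assoc_mult_mat_vec[OF G mult_carrier_mat[OF H G]] ps) (auto simp: spread_def)
    also have "(hadamard_mats ?d (ps t) * toggle_mat n M ?N (g t)) *\<^sub>v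
        spread ?d ?N (\<lambda>x. basis_index ?K ?N (g t x) 0 x) ?\<psi>' =
      hadamard_mats ?d (ps t) *\<^sub>v (toggle_mat n M ?N (g t) *\<^sub>v
        spread ?d ?N (\<lambda>x. basis_index ?K ?N (g t x) 0 x) ?\<psi>')"
      by (intro assoc_mult_mat_vec[OF H G] ps) (auto simp: spread_def)
    also have "toggle_mat n M ?N (g t) *\<^sub>v spread ?d ?N (\<lambda>x. basis_index ?K ?N (g t x) 0 x) ?\<psi>' =
      embed ?d ?N ?\<psi>'"
      unfolding zero using g K by (subst toggle_mat_spread) auto
    also have "hadamard_mats ?d (ps t) *\<^sub>v \<dots> = embed ?d ?N (evolve n w L g \<phi> ps (Suc t))"
      by (subst embed_hadamard) (use ps in \<open>auto simp: c_def\<close>)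
    also have "toggle_mat n M ?N (g (Suc t)) *\<^sub>v \<dots> =
      spread ?d ?N (\<lambda>x. basis_index ?K ?N (g (Suc t) x) 0 x) (evolve n w L g \<phi> ps (Suc t))"
      unfolding zero using K by (subst toggle_mat_spread) auto
    finally show ?case .
  }
qed

lemma output_prob_phase_algorithm:
  assumes w: "w \<in> weight_functions n M" and g0: "\<And>x. g T x = 0"
  shows "output_prob n M (phase_algorithm n M L T g \<phi> ps out) w P =
    (\<Sum>x | x < 2 ^ L \<and> P (out x). (cmod (evolve n w L g \<phi> ps T x))\<^sup>2)"
proof -
  let ?N = "2 ^ L" let ?d = "state_dim n M (2 ^ L)" and ?K = "answer_dim n M"
  let ?A = "phase_algorithm n M L T g \<phi> ps out"
  have Nd: "?N \<le> ?d" using n M by (simp add: state_dim_def answer_dim_def)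
  have "state_after n M ?A w (num_queries ?A) = embed ?d ?N (evolve n w L g \<phi> ps T)"
    using state_after_phase_algorithm[OF w, of T] Nd
    by (simp add: phase_algorithm_def Let_def g0 spread_eq_embed basis_index_def)
  then have "output_prob n M ?A w P =
      (\<Sum>i | i < ?d \<and> P (out i). (cmod (if i < ?N then evolve n w L g \<phi> ps T i else 0))\<^sup>2)"
    by (simp add: output_prob_def phase_algorithm_def Let_def embed_def cong: conj_cong)
  also have "\<dots> = (\<Sum>x | x < ?N \<and> P (out x). (cmod (if x < ?N then evolve n w L g \<phi> ps T x else 0))\<^sup>2)"
    using Nd by (intro sum.mono_neutral_right) auto
  also have "\<dots> = (\<Sum>x | x < ?N \<and> P (out x). (cmod (evolve n w L g \<phi> ps T x))\<^sup>2)"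
    by (intro sum.cong) auto
  finally show ?thesis .
qed

end


section \<open>Counting bit strings\<close>

text \<open>Flipping a bit exchanges the strings with its two possible values, so each further
  prescribed bit halves the count.\<close>

lemma card_prescribed_bits:
  assumes "finite P" "P \<subseteq> {..<D}"
  shows "card {h::nat. h < 2 ^ D \<and> (\<forall>p\<in>P. bit h p = f p)} * 2 ^ card P = 2 ^ D"
  using assms
proof (induction P)
  case (insert p P)
  let ?A = "\<lambda>b. {h::nat. h < 2 ^ D \<and> (\<forall>p\<in>P. bit h p = f p) \<and> bit h p = b}"
  have "bij_betw (flip_bit p) (?A (f p)) (?A (\<not> f p))"
    by (rule bij_betwI[where g = "flip_bit p"]) (use insert in \<open>auto intro: flip_bit_less_power split: if_splits\<close>)
  then have "card (?A (f p)) = card (?A (\<not> f p))"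
    by (rule bij_betw_same_card)
  moreover have "{h::nat. h < 2 ^ D \<and> (\<forall>p\<in>P. bit h p = f p)} = ?A (f p) \<union> ?A (\<not> f p)"
    by auto
  moreover have "card (?A (f p) \<union> ?A (\<not> f p)) = card (?A (f p)) + card (?A (\<not> f p))"
    by (rule card_Un_disjoint) auto
  ultimately have "card {h::nat. h < 2 ^ D \<and> (\<forall>p\<in>P. bit h p = f p)} = 2 * card (?A (f p))"
    by simp
  moreover have "?A (f p) = {h::nat. h < 2 ^ D \<and> (\<forall>q\<in>insert p P. bit h q = f q)}"
    by auto
  ultimately show ?case using insert by (simp add: algebra_simps)
qed auto

section \<open>Effect of Hadamard layers on supports, symmetries and norms\<close>

section \<open>Hadamard gates and supports\<close>

lemma fold_hadamard_op_init:
  "fold hadamard_op [0..<k] (\<lambda>x. if x = 0 then 1 else 0) = (\<lambda>x. if x < 2 ^ k then 1 / sqrt 2 ^ k else 0)"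
proof (induction k)
  case (Suc k)
  have "hadamard_op k (\<lambda>x. if x < 2 ^ k then 1 / sqrt 2 ^ k else 0) x =
    (if x < 2 ^ Suc k then 1 / sqrt 2 ^ Suc k else 0)" for x
  proof -
    have 1: "\<not> bit x k \<and> \<not> flip_bit k x < 2 ^ k" if "x < 2 ^ k"
    proof -
      have "\<not> bit x k" using that by (simp add: bit_iff_odd)
      moreover then have "bit (flip_bit k x) k" by simp
      ultimately show ?thesis by (auto simp: bit_iff_odd)
    qed
    have 2: "bit x k \<and> flip_bit k x < 2 ^ k" if x: "\<not> x < 2 ^ k" "x < 2 ^ Suc k"
    proof -
      have "x div 2 ^ k = 1" using x by (simp add: div_nat_eqI)
      then have b: "bit x k" by (simp add: bit_iff_odd)
      have "flip_bit k x = take_bit k (flip_bit k x)"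
      proof (rule bit_eqI)
        fix m
        have "take_bit (Suc k) x = x" using x by (simp add: take_bit_nat_eq_self_iff)
        then have "bit x m \<Longrightarrow> m < Suc k" by (metis bit_take_bit_iff)
        then show "bit (flip_bit k x) m \<longleftrightarrow> bit (take_bit k (flip_bit k x)) m"
          using b by (auto simp: bit_take_bit_iff less_Suc_eq)
      qed
      then show ?thesis using b by (metis take_bit_nat_less_exp)
    qed
    have 3: "\<not> flip_bit k x < 2 ^ k" if "\<not> x < 2 ^ Suc k"
    proof
      assume "flip_bit k x < 2 ^ k"
      then have "flip_bit k x < 2 ^ Suc k" by simp
      then show False using flip_bit_less_power[of k "Suc k" "flip_bit k x"] that by auto
    qed
    show ?thesis
    proof (cases "x < 2 ^ k")
      case True
      then show ?thesis using 1 by (simp add: hadamard_op_def)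
    next
      case False
      then show ?thesis using 2 3 by (cases "x < 2 ^ Suc k") (auto simp: hadamard_op_def)
    qed
  qed
  then show ?case using Suc by auto
qed auto

lemma hadamard_op_support:
  assumes "\<And>x. \<psi> x \<noteq> 0 \<Longrightarrow> P x" "\<And>x. P (flip_bit p x) \<longleftrightarrow> P x" "hadamard_op p \<psi> x \<noteq> 0"
  shows "P x"
proof -
  have "\<psi> x \<noteq> 0 \<or> \<psi> (flip_bit p x) \<noteq> 0"
    using assms(3) by (auto simp: hadamard_op_def)
  then show ?thesis using assms(1,2) by metis
qed

text \<open>A gate mixes the amplitudes of a string and its flip only, so a property invariant under
  the flips of all touched bits keeps confining the support.\<close>

lemma fold_hadamard_op_support:
  assumes "\<And>x. \<psi> x \<noteq> 0 \<Longrightarrow> P x" "\<And>p x. p \<in> set l \<Longrightarrow> P (flip_bit p x) \<longleftrightarrow> P x"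
    "fold hadamard_op l \<psi> x \<noteq> 0"
  shows "P x"
  using assms
proof (induction l arbitrary: \<psi>)
  case (Cons p l)
  show ?case
  proof (rule Cons.IH[of "hadamard_op p \<psi>"])
    show "P y" if "hadamard_op p \<psi> y \<noteq> 0" for y
      using hadamard_op_support[of \<psi> P p y] Cons.prems that by auto
  qed (use Cons.prems in auto)
qed simp

lemma hadamard_op_flip:
  assumes "p \<noteq> q" "\<psi> (flip_bit q x) = s * \<psi> x" "\<psi> (flip_bit q (flip_bit p x)) = s * \<psi> (flip_bit p x)"
  shows "hadamard_op p \<psi> (flip_bit q x) = s * hadamard_op p \<psi> x"
  using assms by (auto simp: hadamard_op_def flip_bit_commute[of p q] algebra_simps add_divide_distrib
      diff_divide_distrib)

lemma fold_hadamard_op_flip: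
  assumes "q \<notin> set l" "\<And>x. \<psi> (flip_bit q x) = \<psi> x"
  shows "fold hadamard_op l \<psi> (flip_bit q x) = fold hadamard_op l \<psi> x"
  using assms
proof (induction l arbitrary: \<psi>)
  case (Cons p l)
  then show ?case using hadamard_op_flip[of p q \<psi> _ 1] by auto
qed simp

text \<open>Exact interference: a qubit whose amplitudes differ by a factor \<open>s = \<plusminus>1\<close> is measured with certainty.\<close>

lemma fold_hadamard_op_interference:
  assumes "distinct l" "p \<in> set l"
    and "\<And>x. R x \<Longrightarrow> \<psi> (flip_bit p x) = (if s then - \<psi> x else \<psi> x)"
    and "\<And>q x. q \<in> set l \<Longrightarrow> R (flip_bit q x) \<longleftrightarrow> R x"
    and "fold hadamard_op l \<psi> x \<noteq> 0" "R x"
  shows "bit x p = s"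
  using assms
proof (induction l arbitrary: \<psi>)
  case (Cons q l)
  show ?case
  \<comment> \<open>The gate on \<open>p\<close> itself cancels the amplitudes with the wrong bit,
    and later gates, being on other qubits, do not restore them. A gate on another qubit commutes
    with flipping \<open>p\<close> and so preserves the sign relation.\<close>
  proof (cases "q = p")
    case True
    have "R x \<longrightarrow> bit x p = s"
    proof (rule fold_hadamard_op_support[of "hadamard_op p \<psi>" "\<lambda>x. R x \<longrightarrow> bit x p = s" l])
      fix y assume "hadamard_op p \<psi> y \<noteq> 0"
      then show "R y \<longrightarrow> bit y p = s"
        using Cons.prems(3)[of y] by (cases s) (auto simp: hadamard_op_def split: if_splits)
    next
      fix r y assume "r \<in> set l"
      then show "(R (flip_bit r y) \<longrightarrow> bit (flip_bit r y) p = s) \<longleftrightarrow> (R y \<longrightarrow> bit y p = s)"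
        using Cons.prems True by auto
    qed (use Cons.prems True in auto)
    then show ?thesis using Cons.prems by simp
  next
    case False
    show ?thesis
    proof (rule Cons.IH[of "hadamard_op q \<psi>"])
      fix y assume "R y"
      then have "R (flip_bit q y)" using Cons.prems by simp
      then show "hadamard_op q \<psi> (flip_bit p y) =
          (if s then - hadamard_op q \<psi> y else hadamard_op q \<psi> y)"
        using hadamard_op_flip[OF False, of \<psi> y "if s then -1 else 1"] Cons.prems(3) \<open>R y\<close>
        by (auto split: if_splits)
    qed (use Cons.prems False in auto)
  qed
qed simp

text \<open>The parallelogram law on each pair of a string and its flip.\<close>

lemma hadamard_op_norm:
  assumes "finite X" "\<And>x. x \<in> X \<Longrightarrow> flip_bit p x \<in> X"
  shows "(\<Sum>x\<in>X. (cmod (hadamard_op p \<psi> x))\<^sup>2) = (\<Sum>x\<in>X. (cmod (\<psi> x))\<^sup>2)"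
proof -
  have re: "(\<Sum>x\<in>X. f (flip_bit p x)) = sum f X" for f :: "nat \<Rightarrow> real"
    by (rule sum.reindex_bij_betw, rule bij_betwI[where g = "flip_bit p"]) (use assms in auto)
  have pair: "(cmod (hadamard_op p \<psi> x))\<^sup>2 + (cmod (hadamard_op p \<psi> (flip_bit p x)))\<^sup>2 =
    (cmod (\<psi> x))\<^sup>2 + (cmod (\<psi> (flip_bit p x)))\<^sup>2" for x
  proof -
    have *: "(cmod ((a + b) / sqrt 2))\<^sup>2 + (cmod ((a - b) / sqrt 2))\<^sup>2 = (cmod a)\<^sup>2 + (cmod b)\<^sup>2"
      for a b :: complex
    proof -
      have "(cmod (a + b))\<^sup>2 + (cmod (a - b))\<^sup>2 = 2 * ((cmod a)\<^sup>2 + (cmod b)\<^sup>2)"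
        unfolding cmod_power2 by (simp add: power2_eq_square algebra_simps)
      then show ?thesis by (simp add: norm_divide power_divide add_divide_distrib[symmetric])
    qed
    have "cmod ((a - b) / sqrt 2) = cmod ((b - a) / sqrt 2)" for a b :: complex
      by (simp add: norm_divide norm_minus_commute)
    then show ?thesis
      using *[of "\<psi> x" "\<psi> (flip_bit p x)"] 
      by (cases "bit x p") (auto simp: hadamard_op_def add.commute)
  qed
  have "2 * (\<Sum>x\<in>X. (cmod (hadamard_op p \<psi> x))\<^sup>2) =
    (\<Sum>x\<in>X. (cmod (hadamard_op p \<psi> x))\<^sup>2 + (cmod (hadamard_op p \<psi> (flip_bit p x)))\<^sup>2)"
    by (simp add: sum.distrib re[of "\<lambda>x. (cmod (hadamard_op p \<psi> x))\<^sup>2"])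
  also have "\<dots> = 2 * (\<Sum>x\<in>X. (cmod (\<psi> x))\<^sup>2)"
    unfolding pair by (simp add: sum.distrib re[of "\<lambda>x. (cmod (\<psi> x))\<^sup>2"])
  finally show ?thesis by simp
qed

lemma fold_hadamard_op_norm:
  assumes "finite X" "\<And>p x. p \<in> set l \<Longrightarrow> x \<in> X \<Longrightarrow> flip_bit p x \<in> X"
  shows "(\<Sum>x\<in>X. (cmod (fold hadamard_op l \<psi> x))\<^sup>2) = (\<Sum>x\<in>X. (cmod (\<psi> x))\<^sup>2)"
  using assms(2) by (induction l arbitrary: \<psi>) (auto simp: hadamard_op_norm[OF assms(1)])

section \<open>Cuts as functions of vertex sets, and a difference of cuts without quadratic
  part\<close>

section \<open>Cut values\<close>

definition cut_value :: "nat \<Rightarrow> (nat set \<Rightarrow> int) \<Rightarrow> nat set \<Rightarrow> int" where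
  "cut_value n w A = (\<Sum>v\<in>A. \<Sum>u\<in>{..<n} - A. w {u, v})"

definition degree_into :: "nat \<Rightarrow> (nat set \<Rightarrow> int) \<Rightarrow> nat set \<Rightarrow> nat \<Rightarrow> int" where
  "degree_into n w S v = (\<Sum>u\<in>S \<inter> {..<n}. w {u, v})"

lemma bit_set_encode: "finite A \<Longrightarrow> bit (set_encode A) v \<longleftrightarrow> v \<in> A"
  using set_encode_inverse[of A] by (auto simp: set_decode_def bit_iff_odd)

lemma set_encode_less:
  assumes "A \<subseteq> {..<n}"
  shows "set_encode A < 2 ^ n"
proof -
  have f: "finite A" using assms finite_subset by blast
  have "take_bit n (set_encode A) = set_encode A"
    using assms by (intro bit_eqI) (auto simp: bit_take_bit_iff bit_set_encode[OF f])
  then show ?thesis by (simp add: take_bit_nat_eq_self_iff)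
qed

lemma cut_query_set_encode:
  assumes "A \<subseteq> {..<n}"
  shows "cut_query n w (query_vec n (set_encode A)) = cut_value n w A"
proof -
  have f: "finite A" using assms finite_subset by blast
  have inner: "(\<Sum>u<n. (if u \<notin> A then w {u, v} else 0)) = (\<Sum>u\<in>{..<n} - A. w {u, v})" for v
    by (rule sum.mono_neutral_cong_right) auto
  have "cut_query n w (query_vec n (set_encode A)) =
    (\<Sum>u<n. \<Sum>v<n. (1 - (if u \<in> A then 1 else 0)) * ((if u = v then 0 else w {u, v}) * (if v \<in> A then 1 else 0)))"
    unfolding cut_query_def query_vec_def adjacency_matrix_def
    by (auto simp: scalar_prod_def sum_distrib_left lessThan_atLeast0 bit_set_encode[OF f] intro!: sum.cong)
  also have "\<dots> = (\<Sum>u<n. \<Sum>v<n. if v \<in> A then (if u \<notin> A then w {u, v} else 0) else 0)"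
    by (intro sum.cong) auto
  also have "\<dots> = (\<Sum>v<n. if v \<in> A then \<Sum>u<n. (if u \<notin> A then w {u, v} else 0) else 0)"
    by (subst sum.swap) (auto intro!: sum.cong)
  also have "\<dots> = (\<Sum>v\<in>{..<n} \<inter> {v. v \<in> A}. \<Sum>u<n. (if u \<notin> A then w {u, v} else 0))"
    by (subst sum.inter_restrict[symmetric]) (auto simp: Int_def)
  also have "{..<n} \<inter> {v. v \<in> A} = A" using assms by auto
  finally show ?thesis unfolding cut_value_def inner .
qed

text \<open>Moving \<open>v\<close> across the cut adds its edges to the outside and removes those
  into \<open>A\<close>; measured against the full degree of \<open>v\<close>, the latter count
  twice.\<close>

lemma cut_value_insert:
  assumes "A \<subseteq> {..<n}" "v < n" "v \<notin> A"
  shows "cut_value n w (insert v A) =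
    cut_value n w A + (\<Sum>u\<in>{..<n} - {v}. w {u, v}) - 2 * (\<Sum>u\<in>A. w {u, v})"
proof -
  have f: "finite A" using assms finite_subset by blast
  have 1: "(\<Sum>u\<in>{..<n} - insert v A. w {u, v}) = (\<Sum>u\<in>{..<n} - {v}. w {u, v}) - (\<Sum>u\<in>A. w {u, v})"
  proof -
    have "{..<n} - insert v A = ({..<n} - {v}) - A" by auto
    then show ?thesis using assms by (simp add: sum_diff subset_Diff_insert)
  qed
  have 2: "(\<Sum>u\<in>{..<n} - insert v A. w {u, x}) = (\<Sum>u\<in>{..<n} - A. w {u, x}) - w {x, v}" for x
  proof -
    have "{..<n} - insert v A = ({..<n} - A) - {v}" by auto
    then show ?thesis using assms by (simp add: sum_diff insert_commute)
  qed
  have "cut_value n w (insert v A) =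
    (\<Sum>u\<in>{..<n} - insert v A. w {u, v}) + (\<Sum>x\<in>A. \<Sum>u\<in>{..<n} - insert v A. w {u, x})"
    using f assms by (simp add: cut_value_def)
  also have "\<dots> = (\<Sum>u\<in>{..<n} - {v}. w {u, v}) - (\<Sum>u\<in>A. w {u, v}) + (cut_value n w A - (\<Sum>x\<in>A. w {x, v}))"
    unfolding 1 2 by (simp add: cut_value_def sum_subtractf)
  finally show ?thesis by simp
qed

text \<open>The quadratic part of the cut function cancels in this difference.\<close>

lemma cut_value_difference:
  assumes "T \<subseteq> {..<n}" "S \<subseteq> {..<n}" "v < n" "v \<notin> S" "v \<notin> T"
  shows "cut_value n w (insert v T - S) - cut_value n w (insert v T \<union> S) =
    cut_value n w (T - S) - cut_value n w (T \<union> S) + 2 * degree_into n w S v"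
proof -
  have eq: "insert v T - S = insert v (T - S)" "insert v T \<union> S = insert v (T \<union> S)"
    using assms by auto
  have f: "finite T" "finite S" using assms finite_subset by blast+
  have "(\<Sum>u\<in>T \<union> S. w {u, v}) = (\<Sum>u\<in>(T - S) \<union> S. w {u, v})"
    by (simp add: Un_Diff_cancel2)
  also have "\<dots> = (\<Sum>u\<in>T - S. w {u, v}) + (\<Sum>u\<in>S. w {u, v})"
    using f by (intro sum.union_disjoint) auto
  finally have "(\<Sum>u\<in>T \<union> S. w {u, v}) = (\<Sum>u\<in>T - S. w {u, v}) + degree_into n w S v"
    using assms by (simp add: degree_into_def Int_absorb2)
  moreover have "T - S \<subseteq> {..<n}" "v \<notin> T - S" "T \<union> S \<subseteq> {..<n}" "v \<notin> T \<union> S"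
    using assms by auto
  ultimately show ?thesis
    unfolding eq using cut_value_insert[of "T - S" n v w] cut_value_insert[of "T \<union> S" n v w] assms
    by simp
qed


section \<open>Exact tests by interference of two cut phases\<close>

section \<open>Adaptive neighbour tests\<close>

definition block :: "nat \<Rightarrow> nat \<Rightarrow> nat \<Rightarrow> nat \<Rightarrow> nat set" where
  "block n Lr \<tau> x = {v. v < n \<and> bit x (Lr + \<tau> * n + v)}"

text \<open>The outcome for \<open>v\<close> has bias \<open>cos (\<pi> d / 2\<^sup>j)\<close>, where \<open>d\<close> is the degree of \<open>v\<close> into \<open>S\<close>, so it is
  deterministic in exactly these two cases.\<close>

definition consistent ::
  "nat \<Rightarrow> nat \<Rightarrow> (nat set \<Rightarrow> int) \<Rightarrow> nat set \<Rightarrow> nat \<Rightarrow> nat \<Rightarrow> nat \<Rightarrow> bool" where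
  "consistent n Lr w S j \<tau> x \<longleftrightarrow> (\<forall>v<n. v \<notin> S \<longrightarrow>
     (2 ^ Suc j dvd degree_into n w S v \<longrightarrow> v \<notin> block n Lr \<tau> x) \<and>
     (degree_into n w S v mod 2 ^ Suc j = 2 ^ j \<longrightarrow> v \<in> block n Lr \<tau> x))"

text \<open>The angle is a whole number of turns, plus half a turn exactly if \<open>s\<close>
  holds.\<close>

lemma cis_half_turn:
  fixes c :: int
  assumes "if s then c mod 2 ^ Suc j = 2 ^ j else 2 ^ Suc j dvd c"
  shows "cis (2 * pi * of_int c / 2 ^ Suc j) = (if s then -1 else 1)"
proof -
  define k where "k = c div 2 ^ Suc j"
  have c: "c = 2 ^ Suc j * k + (if s then 2 ^ j else 0)"
  proof (cases s)
    case True
    then have "c mod 2 ^ Suc j = 2 ^ j" using assms by simp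
    then show ?thesis using True mult_div_mod_eq[of "2 ^ Suc j" c] unfolding k_def by metis
  next
    case False
    then have "2 ^ Suc j dvd c" using assms by simp
    then show ?thesis using False by (simp add: k_def del: power_Suc)
  qed
  have "2 * pi * of_int c / 2 ^ Suc j = 2 * pi * of_int k + (if s then pi else 0)"
    unfolding c by (simp add: field_simps)
  moreover have "cis (2 * pi * of_int k) = 1"
    by (intro cis_multiple_2pi) auto
  ultimately show ?thesis by (simp flip: cis_mult)
qed

text \<open>The assumption on \<open>S\<close> is causality: a test set may depend only on the seed
  and on the outcome groups of earlier tests. Gates on its own and later groups then leave it fixed,
  so adaptivity needs no intermediate measurement.\<close>

context
  fixes n M Lr Q :: nat and S :: "nat \<Rightarrow> nat \<Rightarrow> nat set" and lev :: "nat \<Rightarrow> nat"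
  assumes n: "0 < n" and M: "0 < M"
    and S: "\<And>\<tau> x y. take_bit (Lr + \<tau> * n) x = take_bit (Lr + \<tau> * n) y \<Longrightarrow> S \<tau> x = S \<tau> y"
    and S_subset: "\<And>\<tau> x. S \<tau> x \<subseteq> {..<n}"
begin

text \<open>Test \<open>\<tau>\<close> consists of the phase queries \<open>2 * \<tau>\<close> and
  \<open>2 * \<tau> + 1\<close>, one for each of the two cuts in the difference. The zero query at
  the end empties the query register before the measurement.\<close>

definition test_query :: "nat \<Rightarrow> nat \<Rightarrow> nat" where
  "test_query t x =
    (if 2 * Q \<le> t then 0
     else if even t then set_encode (block n Lr (t div 2) x \<union> S (t div 2) x)
     else set_encode (block n Lr (t div 2) x - S (t div 2) x))"

definition test_phase :: "nat \<Rightarrow> nat \<Rightarrow> complex" where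
  "test_phase t c = cis ((if even t then -1 else 1) * (pi * real c / 2 ^ Suc (lev (t div 2))))"

definition test_positions :: "nat \<Rightarrow> nat list" where
  "test_positions t = (if even t \<or> 2 * Q \<le> t then [] else [Lr + (t div 2) * n..<Lr + Suc (t div 2) * n])"

lemma block_subset: "block n Lr \<tau> x \<subseteq> {..<n}"
  by (auto simp: block_def)

lemma test_query_less: "test_query t x < 2 ^ n"
proof -
  have "block n Lr \<tau> x \<union> S \<tau> x \<subseteq> {..<n}" "block n Lr \<tau> x - S \<tau> x \<subseteq> {..<n}" for \<tau>
    using block_subset S_subset by auto
  then show ?thesis by (simp add: test_query_def set_encode_less)
qed

lemma test_positions_subset: "set (test_positions t) \<subseteq> {..<Lr + Q * n}"
proof -
  have "Suc (t div 2) * n \<le> Q * n" if "\<not> 2 * Q \<le> t"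
    using that by (intro mult_right_mono) auto
  then show ?thesis by (auto simp: test_positions_def)
qed

lemma S_flip: "Lr + \<tau> * n \<le> p \<Longrightarrow> S \<tau> (flip_bit p x) = S \<tau> x"
  by (intro S take_bit_flip_bit)

lemma block_flip: "Lr + Suc \<tau> * n \<le> p \<Longrightarrow> block n Lr \<tau> (flip_bit p x) = block n Lr \<tau> x"
  by (auto simp: block_def)

context
  fixes w assumes w: "w \<in> weight_functions n M"
begin

definition test_state :: "nat \<Rightarrow> nat \<Rightarrow> complex" where
  "test_state \<tau> = evolve n w (Lr + Q * n) test_query test_phase test_positions (2 * \<tau>)"

definition test_factor :: "nat \<Rightarrow> nat \<Rightarrow> complex" where
  "test_factor \<tau> x = cis (pi * of_int (cut_value n w (block n Lr \<tau> x - S \<tau> x) -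
     cut_value n w (block n Lr \<tau> x \<union> S \<tau> x)) / 2 ^ Suc (lev \<tau>))"

text \<open>No Hadamard gates act between the two phase queries of a test, so their phases multiply
  to the phase of the difference of the cuts.\<close>

lemma test_state_Suc:
  assumes "\<tau> < Q"
  shows "test_state (Suc \<tau>) =
    fold hadamard_op [Lr + \<tau> * n..<Lr + Suc \<tau> * n] (\<lambda>x. test_factor \<tau> x * test_state \<tau> x)"
proof -
  define A B where "A x = block n Lr \<tau> x \<union> S \<tau> x" and "B x = block n Lr \<tau> x - S \<tau> x" for x
  have sub: "A x \<subseteq> {..<n}" "B x \<subseteq> {..<n}" for x
    using block_subset S_subset by (auto simp: A_def B_def)
  have nonneg: "0 \<le> cut_value n w X" if "X \<subseteq> {..<n}" for X
    using cut_query_range[OF n M w, of "set_encode X"] cut_query_set_encode[OF that] by simp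
  have q: "test_query (2 * \<tau>) x = set_encode (A x)" "test_query (Suc (2 * \<tau>)) x = set_encode (B x)" for x
    using assms by (auto simp: test_query_def A_def B_def)
  have "test_phase (Suc (2 * \<tau>)) (nat (cut_value n w (B x))) * test_phase (2 * \<tau>) (nat (cut_value n w (A x))) =
    test_factor \<tau> x" for x
    using nonneg[OF sub(1)] nonneg[OF sub(2)]
    by (simp add: test_phase_def test_factor_def cis_mult A_def B_def diff_divide_distrib right_diff_distrib)
  then show ?thesis
    using assms by (simp add: test_state_def q cut_query_set_encode sub test_positions_def flip: mult.assoc)
qed

lemma test_factor_flip_other:
  "Lr + Suc \<tau> * n \<le> p \<Longrightarrow> test_factor \<tau> (flip_bit p x) = test_factor \<tau> x"
  by (simp add: test_factor_def block_flip S_flip)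

text \<open>By \<open>cut_value_difference\<close>, adding \<open>v\<close> to the queried set
  rotates the phase by a multiple of half a turn.\<close>

lemma test_factor_flip:
  assumes "v < n" "v \<notin> S \<tau> x"
    and "if s then degree_into n w (S \<tau> x) v mod 2 ^ Suc (lev \<tau>) = 2 ^ lev \<tau>
         else 2 ^ Suc (lev \<tau>) dvd degree_into n w (S \<tau> x) v"
  shows "test_factor \<tau> (flip_bit (Lr + \<tau> * n + v) x) = (if s then - test_factor \<tau> x else test_factor \<tau> x)"
proof -
  let ?p = "Lr + \<tau> * n + v"
  have Sf: "S \<tau> (flip_bit ?p x) = S \<tau> x" for x by (intro S_flip) simp
  have *: "test_factor \<tau> (flip_bit ?p x) = (if s then - test_factor \<tau> x else test_factor \<tau> x)"
    if v: "v \<notin> block n Lr \<tau> x" and "v \<notin> S \<tau> x"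
      and deg: "if s then degree_into n w (S \<tau> x) v mod 2 ^ Suc (lev \<tau>) = 2 ^ lev \<tau>
         else 2 ^ Suc (lev \<tau>) dvd degree_into n w (S \<tau> x) v" for x
  proof -
    have "block n Lr \<tau> (flip_bit ?p x) = insert v (block n Lr \<tau> x)"
      using v assms(1) by (auto simp: block_def)
    then have "test_factor \<tau> (flip_bit ?p x) = test_factor \<tau> x *
        cis (2 * pi * of_int (degree_into n w (S \<tau> x) v) / 2 ^ Suc (lev \<tau>))"
      using cut_value_difference[OF block_subset S_subset assms(1) that(2,1), of w]
      by (simp add: test_factor_def Sf cis_mult add_divide_distrib distrib_left mult.assoc
          mult.left_commute)
    then show ?thesis using cis_half_turn[OF deg] by simp
  qed
  show ?thesis
  proof (cases "v \<in> block n Lr \<tau> x")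
    case False
    then show ?thesis using * assms by blast
  next
    \<comment> \<open>Removing \<open>v\<close> undoes an insertion, and a sign is its own
      inverse.\<close>
    case True
    then have "v \<notin> block n Lr \<tau> (flip_bit ?p x)" by (simp add: block_def)
    then show ?thesis using *[of "flip_bit ?p x"] assms(2,3) by (auto simp: Sf)
  qed
qed

text \<open>Groups of tests not yet performed are still uniformly superposed: amplitudes do not
  depend on their bits.\<close>

lemma test_state_flip:
  assumes "\<tau> \<le> Q" "Lr + \<tau> * n \<le> p" "p < Lr + Q * n"
  shows "test_state \<tau> (flip_bit p x) = test_state \<tau> x"
  using assms
proof (induction \<tau> arbitrary: x)
  case 0
  have "flip_bit p x < 2 ^ (Lr + Q * n) \<longleftrightarrow> x < 2 ^ (Lr + Q * n)"
    using flip_bit_less_power[of p "Lr + Q * n"] 0 by (metis flip_bit_flip_bit)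
  then show ?case by (simp add: test_state_def fold_hadamard_op_init)
next
  case (Suc \<tau>)
  have "fold hadamard_op [Lr + \<tau> * n..<Lr + Suc \<tau> * n] (\<lambda>x. test_factor \<tau> x * test_state \<tau> x) (flip_bit p x) =
     fold hadamard_op [Lr + \<tau> * n..<Lr + Suc \<tau> * n] (\<lambda>x. test_factor \<tau> x * test_state \<tau> x) x"
    using Suc by (intro fold_hadamard_op_flip) (auto simp: test_factor_flip_other)
  then show ?case using Suc.prems by (simp add: test_state_Suc)
qed

text \<open>Earlier outcomes survive because the new gates touch neither their groups nor their test
  sets. The new outcome is forced by interference, one vertex at a time.\<close>

lemma test_state_support:
  assumes "\<tau> \<le> Q" "test_state \<tau> x \<noteq> 0" "\<tau>' < \<tau>"
  shows "consistent n Lr w (S \<tau>' x) (lev \<tau>') \<tau>' x"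
  using assms
proof (induction \<tau> arbitrary: x)
  case (Suc \<tau>)
  let ?l = "[Lr + \<tau> * n..<Lr + Suc \<tau> * n]" and ?\<psi> = "\<lambda>x. test_factor \<tau> x * test_state \<tau> x"
  have nz: "fold hadamard_op ?l ?\<psi> x \<noteq> 0" using Suc.prems by (simp add: test_state_Suc)
  show ?case
  proof (cases "\<tau>' = \<tau>")
    case False
    then have lt: "\<tau>' < \<tau>" using Suc.prems by simp
    show ?thesis
    proof (rule fold_hadamard_op_support[OF _ _ nz])
      show "consistent n Lr w (S \<tau>' y) (lev \<tau>') \<tau>' y" if "?\<psi> y \<noteq> 0" for y
        using Suc that lt by auto
      fix p y assume p: "p \<in> set ?l"
      have "Lr + Suc \<tau>' * n \<le> Lr + \<tau> * n"
        using lt by (intro add_left_mono mult_right_mono) auto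
      then have "Lr + Suc \<tau>' * n \<le> p" using p by auto
      then show "consistent n Lr w (S \<tau>' (flip_bit p y)) (lev \<tau>') \<tau>' (flip_bit p y) \<longleftrightarrow>
        consistent n Lr w (S \<tau>' y) (lev \<tau>') \<tau>' y"
        by (simp add: consistent_def S_flip block_flip)
    qed
  next
    case True
    have *: "v \<in> block n Lr \<tau> x \<longleftrightarrow> s" if v: "v < n" "v \<notin> S \<tau> x"
      and deg: "if s then degree_into n w (S \<tau> x) v mod 2 ^ Suc (lev \<tau>) = 2 ^ lev \<tau>
         else 2 ^ Suc (lev \<tau>) dvd degree_into n w (S \<tau> x) v" for v s
    proof -
      let ?p = "Lr + \<tau> * n + v"
      \<comment> \<open>The test set is constant under the gates of this group, so interference is
        applied on the slice of basis states that share the test set of \<open>x\<close>.\<close>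
      let ?R = "\<lambda>y. S \<tau> y = S \<tau> x"
      have "bit x ?p = s"
      proof (rule fold_hadamard_op_interference[OF _ _ _ _ nz])
        fix y assume y: "?R y"
        have "test_state \<tau> (flip_bit ?p y) = test_state \<tau> y"
        proof (rule test_state_flip)
          have "Suc \<tau> * n \<le> Q * n" using Suc.prems by (intro mult_right_mono) auto
          then show "?p < Lr + Q * n" using v by simp
        qed (use Suc.prems in auto)
        then show "?\<psi> (flip_bit ?p y) = (if s then - ?\<psi> y else ?\<psi> y)"
          using test_factor_flip[of v \<tau> y s] v deg y by auto
      next
        fix q y assume "q \<in> set ?l"
        then show "?R (flip_bit q y) \<longleftrightarrow> ?R y" by (simp add: S_flip)
      qed (use v in auto)
      then show ?thesis using v by (simp add: block_def)
    qed
    show ?thesis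
      unfolding consistent_def True
      using *[where s=True] *[where s=False] by auto
  qed
qed simp

text \<open>After the initial superposition only phases and gates above the seed bits occur, so
  every seed keeps its weight: the seed is uniformly random.\<close>

lemma test_state_norm:
  assumes "\<tau> \<le> Q" "r < 2 ^ Lr"
  shows "(\<Sum>x | x < 2 ^ (Lr + Q * n) \<and> take_bit Lr x = r. (cmod (test_state \<tau> x))\<^sup>2) = 1 / 2 ^ Lr"
  using assms(1)
proof (induction \<tau>)
  case 0
  let ?X = "{x. x < 2 ^ (Lr + Q * n) \<and> take_bit Lr x = r}"
  have "take_bit Lr x = r \<longleftrightarrow> (\<forall>p<Lr. bit x p = bit r p)" for x
  proof
    assume "take_bit Lr x = r"
    then show "\<forall>p<Lr. bit x p = bit r p" by (metis bit_take_bit_iff)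
  next
    assume "\<forall>p<Lr. bit x p = bit r p"
    moreover have "take_bit Lr r = r" using assms(2) by (simp add: take_bit_nat_eq_self_iff)
    ultimately show "take_bit Lr x = r" by (metis bit_take_bit_iff bit_eqI)
  qed
  then have "?X = {x. x < 2 ^ (Lr + Q * n) \<and> (\<forall>p\<in>{..<Lr}. bit x p = bit r p)}" by auto
  then have eq: "card ?X * 2 ^ Lr = 2 ^ (Lr + Q * n)"
    using card_prescribed_bits[of "{..<Lr}" "Lr + Q * n" "bit r"] by simp
  have c: "real (card ?X) * 2 ^ Lr = 2 ^ (Lr + Q * n)"
    using arg_cong[OF eq, of real] by simp
  have "(\<Sum>x\<in>?X. (cmod (test_state 0 x))\<^sup>2) = (\<Sum>x\<in>?X. 1 / 2 ^ (Lr + Q * n))"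
  proof (rule sum.cong)
    fix x assume x: "x \<in> ?X"
    have "(sqrt 2 ^ k)\<^sup>2 = (2::real) ^ k" for k
      by (metis power_commutes power_mult power_mult_distrib power2_eq_square abs_numeral
          real_sqrt_mult_self)
    then show "(cmod (test_state 0 x))\<^sup>2 = 1 / 2 ^ (Lr + Q * n)"
      using x by (simp add: test_state_def fold_hadamard_op_init norm_divide norm_power power_divide)
  qed simp
  also have "\<dots> = real (card ?X) / (real (card ?X) * 2 ^ Lr)"
    unfolding c by simp
  also have "\<dots> = 1 / 2 ^ Lr"
  proof -
    have "real (card ?X) \<noteq> 0" using c by (metis mult_zero_left power_not_zero zero_neq_numeral)
    then show ?thesis by simp
  qed
  finally show ?case .
next
  case (Suc \<tau>)
  have "Suc \<tau> * n \<le> Q * n" using Suc.prems by (intro mult_right_mono) auto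
  then have "(\<Sum>x | x < 2 ^ (Lr + Q * n) \<and> take_bit Lr x = r. (cmod (test_state (Suc \<tau>) x))\<^sup>2) =
    (\<Sum>x | x < 2 ^ (Lr + Q * n) \<and> take_bit Lr x = r. (cmod (test_factor \<tau> x * test_state \<tau> x))\<^sup>2)"
    using Suc.prems by (subst test_state_Suc, simp, intro fold_hadamard_op_norm)
      (auto simp: take_bit_flip_bit intro!: flip_bit_less_power)
  then show ?case using Suc by (simp add: norm_mult test_factor_def)
qed

text \<open>A seed contributes its whole weight if every outcome consistent with it is accepted,
  since inconsistent basis states have amplitude zero.\<close>

lemma test_algorithm_prob:
  "real (card {r. r < 2 ^ Lr \<and> (\<forall>x. take_bit Lr x = r \<longrightarrow>
      (\<forall>\<tau><Q. consistent n Lr w (S \<tau> x) (lev \<tau>) \<tau> x) \<longrightarrow> P (out x))}) / 2 ^ Lr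
   \<le> output_prob n M (phase_algorithm n M (Lr + Q * n) (2 * Q) test_query test_phase test_positions out) w P"
  (is "real (card ?R) / _ \<le> _")
proof -
  let ?N = "2 ^ (Lr + Q * n)"
  let ?f = "\<lambda>x. (cmod (test_state Q x))\<^sup>2"
  have out: "output_prob n M (phase_algorithm n M (Lr + Q * n) (2 * Q) test_query test_phase test_positions out) w P =
    (\<Sum>x | x < ?N \<and> P (out x). ?f x)"
    unfolding test_state_def
    by (rule output_prob_phase_algorithm[OF n M test_query_less _ test_positions_subset w])
      (auto simp: test_phase_def test_query_def)
  have fin: "finite ?R" by simp
  have "real (card ?R) / 2 ^ Lr = (\<Sum>r\<in>?R. \<Sum>x | x < ?N \<and> take_bit Lr x = r. ?f x)"
    by (simp add: test_state_norm)
  also have "\<dots> = (\<Sum>x\<in>(\<Union>r\<in>?R. {x. x < ?N \<and> take_bit Lr x = r}). ?f x)"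
    by (rule sum.UNION_disjoint[symmetric]) auto
  also have "\<dots> = (\<Sum>x\<in>{x\<in>(\<Union>r\<in>?R. {x. x < ?N \<and> take_bit Lr x = r}). test_state Q x \<noteq> 0}. ?f x)"
    by (rule sum.mono_neutral_right) auto
  also have "\<dots> \<le> (\<Sum>x | x < ?N \<and> P (out x). ?f x)"
    using test_state_support[of Q] by (intro sum_mono2) auto
  finally show ?thesis unfolding out .
qed

end

lemma test_algorithm_valid:
  "valid_algorithm n M (phase_algorithm n M (Lr + Q * n) (2 * Q) test_query test_phase test_positions out)"
  by (rule phase_algorithm_valid[OF n M test_query_less _ test_positions_subset]) (simp add: test_phase_def)

end

section \<open>From degrees modulo powers of two to neighbourhoods\<close>

definition neighbours :: "nat \<Rightarrow> (nat set \<Rightarrow> int) \<Rightarrow> nat set \<Rightarrow> nat set" where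
  "neighbours n w S = {v. v < n \<and> v \<notin> S \<and> (\<exists>u\<in>S. {u, v} \<in> edges n w)}"

lemma weight_bounds:
  assumes "w \<in> weight_functions n M" "u < n" "v < n" "u \<noteq> v"
  shows "{u, v} \<in> vertex_pairs n" "0 \<le> w {u, v}" "w {u, v} < int M"
proof -
  show *: "{u, v} \<in> vertex_pairs n" using assms by (auto simp: vertex_pairs_def)
  then show "0 \<le> w {u, v}" "w {u, v} < int M"
    using assms(1) by (auto simp: weight_functions_def dest: funcset_mem)
qed

text \<open>Weights are nonnegative, so no cancellation can hide an edge.\<close>

lemma degree_into_pos_iff:
  assumes "w \<in> weight_functions n M" "S \<subseteq> {..<n}" "v < n" "v \<notin> S"
  shows "0 < degree_into n w S v \<longleftrightarrow> v \<in> neighbours n w S"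
proof -
  have f: "finite S" and S: "S \<inter> {..<n} = S" using assms finite_subset by blast+
  have b: "{u, v} \<in> vertex_pairs n \<and> 0 \<le> w {u, v}" if "u \<in> S" for u
    using weight_bounds[OF assms(1), of u v] assms that by (auto simp: subset_iff)
  then have "0 \<le> degree_into n w S v \<and> (degree_into n w S v = 0 \<longleftrightarrow> (\<forall>u\<in>S. w {u, v} = 0))"
    unfolding degree_into_def S using f by (auto intro!: sum_nonneg simp: sum_nonneg_eq_0_iff)
  then show ?thesis
    using b assms(3,4) by (force simp: neighbours_def edges_def)
qed

lemma degree_into_less:
  assumes "w \<in> weight_functions n M" "0 < n" "0 < M" "S \<subseteq> {..<n}" "v < n" "v \<notin> S"
  shows "degree_into n w S v < int (n * M)"
proof -
  have S: "S \<inter> {..<n} = S" using assms by auto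
  have "degree_into n w S v \<le> (\<Sum>u\<in>S. int M - 1)"
    unfolding degree_into_def S
  proof (rule sum_mono)
    fix u assume "u \<in> S"
    then have "u < n" "u \<noteq> v" using assms by auto
    then show "w {u, v} \<le> int M - 1" using weight_bounds(3)[OF assms(1) _ assms(5)] by fastforce
  qed
  also have "\<dots> = int (card S) * (int M - 1)" by simp
  also have "\<dots> \<le> int n * (int M - 1)"
    using card_mono[of "{..<n}" S] assms by (intro mult_right_mono) auto
  also have "\<dots> < int (n * M)" using assms by (simp add: algebra_simps)
  finally show ?thesis .
qed

text \<open>The witness is the 2-adic valuation of \<open>c\<close>. It ensures that every positive
  degree is detected with certainty at some level.\<close>

lemma exists_two_adic_valuation:
  fixes c :: int
  assumes "0 < c" "c < 2 ^ J"
  shows "\<exists>j<J. c mod 2 ^ Suc j = 2 ^ j"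
  using assms
proof (induction J arbitrary: c)
  case (Suc J)
  show ?case
  proof (cases "odd c")
    case True
    then have "c mod 2 ^ Suc 0 = 2 ^ 0" by (simp add: odd_iff_mod_2_eq_one)
    then show ?thesis by blast
  next
    case False
    then obtain c' where c': "c = 2 * c'" by (metis dvdE)
    then obtain j where j: "j < J" "c' mod 2 ^ Suc j = 2 ^ j"
      using Suc.IH[of c'] Suc.prems by auto
    have "c mod 2 ^ Suc (Suc j) = 2 * (c' mod 2 ^ Suc j)"
      unfolding c' by (simp only: power_Suc[of 2 "Suc j"] mult_mod_right)
    then show ?thesis using j by (intro exI[of _ "Suc j"]) simp
  qed
qed simp

text \<open>The interface to classical reasoning: a randomized procedure that asks for
  \<open>Q\<close> neighbourhoods, each depending on the seed and the previous answers, becomes a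
  quantum algorithm. Bits of vertices inside the test set carry no information, so answers are
  constrained only after removing that set.\<close>

theorem adaptive_neighbour_tests:
  fixes n M J Lr Q :: nat and S :: "nat \<Rightarrow> nat \<Rightarrow> (nat \<Rightarrow> nat set) \<Rightarrow> nat set"
    and out :: "nat \<Rightarrow> (nat \<Rightarrow> nat set) \<Rightarrow> 'a"
  assumes n: "0 < n" and M: "0 < M" and J: "n * M \<le> 2 ^ J"
    and S: "\<And>\<sigma> r res res'. (\<And>\<sigma>'. \<sigma>' < \<sigma> \<Longrightarrow> res \<sigma>' = res' \<sigma>') \<Longrightarrow> S \<sigma> r res = S \<sigma> r res'"
    and S_subset: "\<And>\<sigma> r res. S \<sigma> r res \<subseteq> {..<n}"
  obtains A :: "'a quantum_algorithm" where "valid_algorithm n M A" "num_queries A = 4 * (Q * J)"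
    "\<And>w P. w \<in> weight_functions n M \<Longrightarrow>
      real (card {r. r < 2 ^ Lr \<and> (\<forall>res. (\<forall>\<sigma><Q. res \<sigma> - S \<sigma> r res = neighbours n w (S \<sigma> r res)) \<longrightarrow> P (out r res))})
      / 2 ^ Lr \<le> output_prob n M A w P"
proof -
  \<comment> \<open>Each question takes \<open>J\<close> consecutive tests, one per level; a vertex
    is reported if any level fires.\<close>
  define raw where "raw x \<sigma> = (\<Union>j<J. block n Lr (\<sigma> * J + j) x)" for x \<sigma>
  define S' where "S' \<tau> x = S (\<tau> div J) (take_bit Lr x) (raw x)" for \<tau> x
  define lev where "lev \<tau> = \<tau> mod J" for \<tau>
  define out' where "out' x = out (take_bit Lr x) (raw x)" for x
  have S': "S' \<tau> x = S' \<tau> y" if eq: "take_bit (Lr + \<tau> * n) x = take_bit (Lr + \<tau> * n) y" for \<tau> x y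
  proof -
    have b: "bit x p = bit y p" if "p < Lr + \<tau> * n" for p
      using eq that by (metis bit_take_bit_iff)
    have "take_bit Lr x = take_bit Lr y"
      by (rule bit_eqI) (auto simp: bit_take_bit_iff b)
    moreover have "raw x \<sigma>' = raw y \<sigma>'" if "\<sigma>' < \<tau> div J" for \<sigma>'
    proof -
      have "block n Lr (\<sigma>' * J + j) x = block n Lr (\<sigma>' * J + j) y" if j: "j < J" for j
      proof -
        have "Suc (\<sigma>' * J + j) \<le> Suc \<sigma>' * J" using j by simp
        also have "\<dots> \<le> \<tau> div J * J" using \<open>\<sigma>' < \<tau> div J\<close> by (intro mult_right_mono) auto
        also have "\<dots> \<le> \<tau>" by simp
        finally have "Suc (\<sigma>' * J + j) * n \<le> \<tau> * n" by (rule mult_right_mono) simp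
        then show ?thesis using b by (auto simp: block_def)
      qed
      then show ?thesis by (auto simp: raw_def)
    qed
    ultimately show ?thesis unfolding S'_def by (metis S)
  qed
  have sub': "S' \<tau> x \<subseteq> {..<n}" for \<tau> x by (simp add: S'_def S_subset)
  let ?A = "phase_algorithm n M (Lr + (Q * J) * n) (2 * (Q * J))
    (test_query n Lr (Q * J) S') (test_phase lev) (test_positions n Lr (Q * J)) out'"
  have result: "raw x \<sigma> - S \<sigma> (take_bit Lr x) (raw x) = neighbours n w (S \<sigma> (take_bit Lr x) (raw x))"
    if w: "w \<in> weight_functions n M" and c: "\<And>\<tau>. \<tau> < Q * J \<Longrightarrow> consistent n Lr w (S' \<tau> x) (lev \<tau>) \<tau> x"
      and \<sigma>: "\<sigma> < Q" for w x \<sigma>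
  proof -
    let ?S = "S \<sigma> (take_bit Lr x) (raw x)"
    have c: "consistent n Lr w ?S j (\<sigma> * J + j) x" if j: "j < J" for j
    proof -
      have "\<sigma> * J + j < Suc \<sigma> * J" using j by simp
      also have "\<dots> \<le> Q * J" using \<sigma> by (intro mult_right_mono) auto
      finally show ?thesis using c[of "\<sigma> * J + j"] j by (simp add: S'_def lev_def)
    qed
    have "v \<in> raw x \<sigma> \<longleftrightarrow> v \<in> neighbours n w ?S" if v: "v < n" "v \<notin> ?S" for v
    proof -
      let ?d = "degree_into n w ?S v"
      have d: "0 < ?d \<longleftrightarrow> v \<in> neighbours n w ?S" and lt: "?d < 2 ^ J"
        using degree_into_pos_iff[OF w S_subset v] degree_into_less[OF w n M S_subset v] J
        by (auto intro: less_le_trans simp flip: of_nat_le_iff[where 'a=int])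
      have d0: "0 \<le> ?d"
        unfolding degree_into_def using weight_bounds[OF w _ v(1)] v by (intro sum_nonneg) auto
      show ?thesis
      \<comment> \<open>A positive degree surely fires at its valuation level, and whatever other
        levels do is harmless. Degree zero fires at no level.\<close>
      proof (cases "0 < ?d")
        case True
        obtain j where "j < J" "?d mod 2 ^ Suc j = 2 ^ j"
          using exists_two_adic_valuation[OF True lt] by blast
        then have "v \<in> block n Lr (\<sigma> * J + j) x"
          using c[of j] v by (auto simp: consistent_def)
        then show ?thesis using d True \<open>j < J\<close> by (auto simp: raw_def)
      next
        case False
        then have "?d = 0" using d0 by simp
        then have "v \<notin> block n Lr (\<sigma> * J + j) x" if "j < J" for j
          using c[OF that] v by (auto simp: consistent_def)
        then show ?thesis using d False by (auto simp: raw_def)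
      qed
    qed
    moreover have "raw x \<sigma> \<subseteq> {..<n}" by (auto simp: raw_def block_def)
    ultimately show ?thesis by (auto simp: neighbours_def)
  qed
  show thesis
  proof (rule that)
    show "valid_algorithm n M ?A"
      by (rule test_algorithm_valid[OF n M S' sub'])
    show "num_queries ?A = 4 * (Q * J)" by (simp add: phase_algorithm_def Let_def)
    fix w P assume w: "w \<in> weight_functions n M"
    let ?R = "{r. r < 2 ^ Lr \<and> (\<forall>res. (\<forall>\<sigma><Q. res \<sigma> - S \<sigma> r res = neighbours n w (S \<sigma> r res)) \<longrightarrow> P (out r res))}"
    let ?R' = "{r. r < 2 ^ Lr \<and> (\<forall>x. take_bit Lr x = r \<longrightarrow>
      (\<forall>\<tau><Q * J. consistent n Lr w (S' \<tau> x) (lev \<tau>) \<tau> x) \<longrightarrow> P (out' x))}"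
    have "?R \<subseteq> ?R'"
      using result[OF w] unfolding out'_def by fastforce
    then have "card ?R \<le> card ?R'" by (intro card_mono) auto
    then have "real (card ?R) / 2 ^ Lr \<le> real (card ?R') / 2 ^ Lr"
      by (intro divide_right_mono) auto
    also have "\<dots> \<le> output_prob n M ?A w P"
      by (rule test_algorithm_prob[OF n M S' sub' w])
    finally show "real (card ?R) / 2 ^ Lr \<le> output_prob n M ?A w P" .
  qed
qed


section \<open>Components under added edges, and existence of spanning forests\<close>

section \<open>Components and forests\<close>

lemma connected_in_iff:
  "(u, v) \<in> connected_in n E \<longleftrightarrow> u < n \<and> v < n \<and> (u, v) \<in> {(u, v). {u, v} \<in> E}\<^sup>*"
  by (auto simp: connected_in_def)

lemma equiv_connected_in: "equiv {..<n} (connected_in n E)"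
proof (rule equivI)
  have "sym {(u, v). {u, v} \<in> E}" by (auto simp: sym_def insert_commute)
  then have "sym ({(u, v). {u, v} \<in> E}\<^sup>*)" by (rule sym_rtrancl)
  then show "sym (connected_in n E)" by (auto simp: sym_def connected_in_iff)
  show "trans (connected_in n E)"
    unfolding trans_def connected_in_iff by (meson rtrancl_trans)
qed (auto simp: refl_on_def connected_in_iff)

definition component_of :: "nat \<Rightarrow> nat set set \<Rightarrow> nat \<Rightarrow> nat set" where
  "component_of n E v = connected_in n E `` {v}"

lemma components_eq_image: "components n E = component_of n E ` {..<n}"
  by (auto simp: components_def quotient_def component_of_def)

lemma finite_components [simp]: "finite (components n E)"
  by (simp add: components_eq_image)

lemma mem_component_of: "u \<in> component_of n E v \<longleftrightarrow> (v, u) \<in> connected_in n E"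
  by (simp add: component_of_def)

lemma component_of_self: "v < n \<Longrightarrow> v \<in> component_of n E v"
  by (simp add: mem_component_of connected_in_iff)

lemma component_of_eq_iff:
  "u < n \<Longrightarrow> v < n \<Longrightarrow> component_of n E u = component_of n E v \<longleftrightarrow> (u, v) \<in> connected_in n E"
  unfolding component_of_def using eq_equiv_class_iff[OF equiv_connected_in, of u n v E] by simp

lemma connected_in_mono: "E \<subseteq> E' \<Longrightarrow> connected_in n E \<subseteq> connected_in n E'"
proof -
  assume "E \<subseteq> E'"
  then have "{(u, v). {u, v} \<in> E} \<subseteq> {(u, v). {u, v} \<in> E'}" by auto
  from rtrancl_mono[OF this] show ?thesis by (auto simp: connected_in_iff)
qed

lemma connected_in_edge: "{u, v} \<in> E \<Longrightarrow> u < n \<Longrightarrow> v < n \<Longrightarrow> (u, v) \<in> connected_in n E"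
  by (auto simp: connected_in_iff)

lemma connected_in_Image_component_of:
  assumes "E \<subseteq> E'" "v < n"
  shows "connected_in n E' `` component_of n E v = component_of n E' v"
proof -
  have "trans (connected_in n E')" using equiv_connected_in by (auto simp: equiv_def)
  moreover have "(v, v) \<in> connected_in n E" using assms(2) by (simp add: connected_in_iff)
  ultimately show ?thesis
    using connected_in_mono[OF assms(1), of n] unfolding component_of_def trans_def by blast
qed

lemma components_image:
  assumes "E \<subseteq> E'"
  shows "(\<lambda>X. connected_in n E' `` X) ` components n E = components n E'"
  by (auto simp: components_eq_image image_image connected_in_Image_component_of[OF assms])

text \<open>Adding edges maps the old components onto the new ones. If the count does not drop, this
  map is injective and nothing was merged.\<close>

lemma components_eqI:
  assumes "E \<subseteq> E'" "card (components n E) \<le> card (components n E')"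
  shows "components n E = components n E'"
proof -
  let ?f = "\<lambda>X. connected_in n E' `` X"
  have "card (?f ` components n E) = card (components n E)"
    using assms(2) card_image_le[of "components n E" ?f] by (simp add: components_image[OF assms(1)])
  then have inj: "inj_on ?f (components n E)"
    by (intro eq_card_imp_inj_on) auto
  have "component_of n E v = component_of n E' v" if v: "v < n" for v
  proof
    show "component_of n E v \<subseteq> component_of n E' v"
      using connected_in_mono[OF assms(1), of n] by (auto simp: mem_component_of)
    show "component_of n E' v \<subseteq> component_of n E v"
    proof
      fix u assume "u \<in> component_of n E' v"
      then have u: "u < n" "(v, u) \<in> connected_in n E'" by (auto simp: mem_component_of connected_in_iff)
      then have "component_of n E' v = component_of n E' u" using v by (simp add: component_of_eq_iff)
      then have "?f (component_of n E v) = ?f (component_of n E u)"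
        using u v by (simp add: connected_in_Image_component_of[OF assms(1)])
      then have "component_of n E v = component_of n E u"
        using inj u v by (auto simp: inj_on_def components_eq_image)
      then show "u \<in> component_of n E v" using component_of_self[OF u(1)] by simp
    qed
  qed
  then show ?thesis by (auto simp: components_eq_image)
qed

text \<open>The rest of the cycle still joins the two ends of the removed edge.\<close>

lemma cycle_edge_redundant:
  assumes "undirected_cycle F vs"
  shows "connected_in n (F - {{vs ! 0, vs ! 1}}) = connected_in n F"
proof
  let ?e = "{vs ! 0, vs ! 1}"
  let ?A = "{(u, v). {u, v} \<in> F - {?e}}"
  have len: "3 \<le> length vs" and dist: "distinct vs"
    and step: "\<And>i. i < length vs \<Longrightarrow> {vs ! i, vs ! (Suc i mod length vs)} \<in> F"
    using assms by (auto simp: undirected_cycle_def)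
  have neq: "vs ! i \<noteq> vs ! j" if "i < length vs" "j < length vs" "i \<noteq> j" for i j
    using dist that by (simp add: nth_eq_iff_index_eq)
  have path: "Suc i < length vs \<Longrightarrow> (vs ! 1, vs ! Suc i) \<in> ?A\<^sup>*" for i
  proof (induction i)
    case (Suc i)
    have ne: "vs \<noteq> []" using len by auto
    have "{vs ! Suc i, vs ! Suc (Suc i)} \<in> F" using step[of "Suc i"] Suc.prems by simp
    moreover have "{vs ! Suc i, vs ! Suc (Suc i)} \<noteq> ?e"
      using neq[of "Suc (Suc i)" 0] neq[of "Suc (Suc i)" 1] Suc.prems ne by (auto simp: doubleton_eq_iff)
    ultimately have "(vs ! Suc i, vs ! Suc (Suc i)) \<in> ?A" by simp
    then show ?case using Suc by (meson Suc_lessD rtrancl.rtrancl_into_rtrancl)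
  qed simp
  define k where "k = length vs - 2"
  have k: "length vs = Suc (Suc k)" "0 < k" using len by (auto simp: k_def)
  have "{vs ! Suc k, vs ! 0} \<in> F" using step[of "Suc k"] k by simp
  moreover have "{vs ! Suc k, vs ! 0} \<noteq> ?e"
    using neq[of "Suc k" 0] neq[of "Suc k" 1] k by (auto simp: doubleton_eq_iff)
  ultimately have "(vs ! Suc k, vs ! 0) \<in> ?A" by simp
  then have 10: "(vs ! 1, vs ! 0) \<in> ?A\<^sup>*" using path[of k] k by (auto intro: rtrancl.rtrancl_into_rtrancl)
  have "sym ?A" by (auto simp: sym_def insert_commute)
  then have 01: "(vs ! 0, vs ! 1) \<in> ?A\<^sup>*" using 10 by (meson sym_rtrancl symD)
  have "{(u, v). {u, v} \<in> F} \<subseteq> ?A\<^sup>*"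
  proof clarify
    fix u v assume uv: "{u, v} \<in> F"
    show "(u, v) \<in> ?A\<^sup>*"
    proof (cases "{u, v} = ?e")
      case True
      then show ?thesis using 01 10 by (auto simp: doubleton_eq_iff)
    next
      case False
      then show ?thesis using uv by auto
    qed
  qed
  then have "{(u, v). {u, v} \<in> F}\<^sup>* \<subseteq> ?A\<^sup>*" by (rule rtrancl_subset_rtrancl)
  then show "connected_in n F \<subseteq> connected_in n (F - {?e})" by (auto simp: connected_in_iff)
qed (auto intro!: connected_in_mono)

text \<open>A subset of minimal size with the same connectivity has no cycle, because a cycle edge
  could be dropped.\<close>

lemma exists_spanning_forest:
  assumes "finite E"
  shows "\<exists>F. spanning_forest n E F"
proof -
  let ?P = "\<lambda>F. F \<subseteq> E \<and> connected_in n F = connected_in n E"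
  obtain F where F: "?P F" and min: "\<And>F'. ?P F' \<Longrightarrow> card F \<le> card F'"
    using ex_has_least_nat[of ?P E card] by auto
  have "undirected_forest F"
    unfolding undirected_forest_def
  proof clarify
    fix vs assume c: "undirected_cycle F vs"
    let ?F' = "F - {{vs ! 0, vs ! 1}}"
    have "3 \<le> length vs" "\<forall>i<length vs. {vs ! i, vs ! (Suc i mod length vs)} \<in> F"
      using c by (auto simp: undirected_cycle_def)
    moreover from this have "0 < length vs" "Suc 0 mod length vs = 1" by auto
    ultimately have "{vs ! 0, vs ! 1} \<in> F" by metis
    then have "card ?F' < card F"
      using F assms finite_subset by (metis card_Diff1_less)
    moreover have "?P ?F'" using F cycle_edge_redundant[OF c] by auto
    ultimately show False using min[of ?F'] by simp
  qed
  then show ?thesis using F by (auto simp: spanning_forest_def components_def)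
qed

section \<open>One Boruvka round and the decoding of its answers\<close>

section \<open>Hooking blue components to red ones\<close>

text \<open>\<open>R\<close> is a union of components, so the hooked components \<open>JB\<close>
  contain no red vertex. Each of them merges with a red one, hence the components outside
  \<open>JB\<close> already reach all new components. Without the two colours, components hooked to
  each other would be counted too often.\<close>

lemma card_components_hook:
  assumes E: "E \<subseteq> E'"
    and closed: "\<And>u v. (u, v) \<in> connected_in n E \<Longrightarrow> u \<in> R \<Longrightarrow> v \<in> R"
  defines "JB \<equiv> component_of n E ` {v. v < n \<and> v \<notin> R \<and> (\<exists>u\<in>R. u < n \<and> {u, v} \<in> E')}"
  shows "card (components n E') + card JB \<le> card (components n E)"
proof -
  let ?f = "\<lambda>X. connected_in n E' `` X"
  have JB: "JB \<subseteq> components n E" by (auto simp: JB_def components_eq_image)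
  have red: "component_of n E u \<notin> JB" if "u \<in> R" "u < n" for u
    using that closed component_of_eq_iff[of u n _ E] by (auto simp: JB_def)
  have "components n E' \<subseteq> ?f ` (components n E - JB)"
  proof
    fix Y assume "Y \<in> components n E'"
    then obtain v where v: "v < n" "Y = component_of n E' v" by (auto simp: components_eq_image)
    have "\<exists>u<n. component_of n E u \<notin> JB \<and> component_of n E' u = Y"
    proof (cases "component_of n E v \<in> JB")
      case True
      then obtain v' u where u: "component_of n E v = component_of n E v'" "v' < n" "u \<in> R" "u < n"
        "{u, v'} \<in> E'" by (auto simp: JB_def)
      then have "component_of n E' v = component_of n E' v'"
        using v by (metis E connected_in_Image_component_of)
      also have "\<dots> = component_of n E' u"
        using u connected_in_edge[of v' u E' n] by (simp add: component_of_eq_iff insert_commute)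
      finally show ?thesis using u red v by auto
    qed (use v in auto)
    then obtain u where u: "u < n" "component_of n E u \<notin> JB" "component_of n E' u = Y" by blast
    have "component_of n E u \<in> components n E" using u(1) by (simp add: components_eq_image)
    then show "Y \<in> ?f ` (components n E - JB)"
      using u(2,3) connected_in_Image_component_of[OF E u(1)] by (intro image_eqI[of _ _ "component_of n E u"]) auto
  qed
  then have "card (components n E') \<le> card (?f ` (components n E - JB))"
    by (intro card_mono) auto
  also have "\<dots> \<le> card (components n E - JB)" by (intro card_image_le) auto
  also have "\<dots> = card (components n E) - card JB" using JB by (intro card_Diff_subset) (auto intro: finite_subset)
  finally show ?thesis using card_mono[OF _ JB] by simp
qed

text \<open>A canonical vertex, so that one seed bit colours a whole component and distinct
  components use distinct bits.\<close>

definition component_label :: "nat \<Rightarrow> nat set set \<Rightarrow> nat \<Rightarrow> nat" where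
  "component_label n E v = Min (component_of n E v)"

lemma component_label_mem:
  assumes "v < n"
  shows "component_label n E v \<in> component_of n E v" "component_label n E v < n"
proof -
  have "component_of n E v \<subseteq> {..<n}" by (auto simp: mem_component_of connected_in_iff)
  then have "finite (component_of n E v)" using finite_subset by blast
  then show *: "component_label n E v \<in> component_of n E v"
    unfolding component_label_def using component_of_self[OF assms] by (intro Min_in) auto
  then show "component_label n E v < n" by (auto simp: mem_component_of connected_in_iff)
qed

lemma component_label_eq_iff:
  assumes "u < n" "v < n"
  shows "component_label n E u = component_label n E v \<longleftrightarrow> component_of n E u = component_of n E v"
proof
  have *: "component_of n E (component_label n E x) = component_of n E x" if "x < n" for x
    using component_label_mem[OF that, of E] component_of_eq_iff[OF that, of "component_label n E x" E] that
    by (simp add: mem_component_of)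
  assume "component_label n E u = component_label n E v"
  then show "component_of n E u = component_of n E v" using * assms by metis
qed (simp add: component_label_def)

text \<open>The seed \<open>s\<close> consists of \<open>n\<close>-bit blocks: block \<open>0\<close> colours the components, block \<open>l + 1\<close> is the
  \<open>l\<close>-th random halving of the vertex set.\<close>

definition red :: "nat \<Rightarrow> nat set set \<Rightarrow> nat \<Rightarrow> nat set" where
  "red n E s = {v. v < n \<and> bit s (component_label n E v)}"

text \<open>Nested samples of rate \<open>2^-i\<close>: the level \<open>i\<close> keeps what
  survives the first \<open>i\<close> halvings.\<close>

definition sample :: "nat \<Rightarrow> nat set set \<Rightarrow> nat \<Rightarrow> nat \<Rightarrow> nat set" where
  "sample n E s i = {u \<in> red n E s. \<forall>l<i. bit s (Suc l * n + u)}"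

text \<open>The ideal result of a round. Rates down to \<open>2^-(t+1)\<close> are included because
  up to \<open>2^t\<close> neighbours must be thinned to an expected number of at most 1/2.\<close>

definition hooks :: "nat \<Rightarrow> (nat set \<Rightarrow> int) \<Rightarrow> nat \<Rightarrow> nat set set \<Rightarrow> nat \<Rightarrow> nat set set" where
  "hooks n w t E s = {{u, v} |u v. v < n \<and> v \<notin> red n E s \<and>
     (\<exists>i<t + 2. {u' \<in> sample n E s i. {u', v} \<in> edges n w} = {u})}"

lemma hooks_subset: "hooks n w t E s \<subseteq> edges n w"
  by (auto simp: hooks_def)

text \<open>The tests ask for neighbours in the sample and in its halves given by each bit of the vertex index,
  so a unique neighbour spells out its own name.\<close>

definition test_set :: "nat \<Rightarrow> nat \<Rightarrow> nat set set \<Rightarrow> nat \<Rightarrow> nat \<Rightarrow> nat set" where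
  "test_set n t E s a = {u \<in> sample n E s (a div (2 * t)). bit u (a mod (2 * t) div 2) = odd a}"

text \<open>The decoder does not see \<open>w\<close>: it accepts \<open>u\<close> for
  \<open>v\<close> if the answers for \<open>v\<close> at one level agree with the membership of
  \<open>u\<close> in every test set.\<close>

definition found :: "nat \<Rightarrow> nat \<Rightarrow> nat set set \<Rightarrow> nat \<Rightarrow> (nat \<Rightarrow> nat set) \<Rightarrow> nat set set" where
  "found n t E s res = {{u, v} |u v. v < n \<and> v \<notin> red n E s \<and>
     (\<exists>i<t + 2. u \<in> sample n E s i \<and>
       (\<forall>a<(t + 2) * (2 * t). a div (2 * t) = i \<longrightarrow> (v \<in> res a \<longleftrightarrow> u \<in> test_set n t E s a)))}"

lemma sample_subset_red: "sample n E s i \<subseteq> red n E s"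
  by (auto simp: sample_def)

lemma red_subset: "red n E s \<subseteq> {..<n}"
  by (auto simp: red_def)

lemma test_set_subset: "test_set n t E s a \<subseteq> sample n E s (a div (2 * t))"
  by (auto simp: test_set_def)

lemma exists_test:
  assumes "i < t + 2" "j < t"
  obtains a where "a < (t + 2) * (2 * t)" "a div (2 * t) = i"
    "test_set n t E s a = {u \<in> sample n E s i. bit u j = c}"
proof
  \<comment> \<open>Inside a level the index packs a bit position and a bit value, the latter as
    parity; the level offset is even and does not disturb it.\<close>
  define b where "b = 2 * j + of_bool c"
  let ?a = "i * (2 * t) + b"
  have b: "b < 2 * t" using assms(2) by (cases c) (auto simp: b_def)
  then have "?a < Suc i * (2 * t)" by simp
  also have "\<dots> \<le> (t + 2) * (2 * t)" using assms(1) by (intro mult_right_mono) auto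
  finally show "?a < (t + 2) * (2 * t)" .
  show d: "?a div (2 * t) = i" using b by simp
  have m: "?a mod (2 * t) = b" using b by simp
  have bj: "b div 2 = j" and o: "odd ?a = c" by (auto simp: b_def)
  show "test_set n t E s ?a = {u \<in> sample n E s i. bit u j = c}"
    unfolding test_set_def d m bj o ..
qed

text \<open>If the answers match \<open>u\<close>, any neighbour \<open>u'\<close> of
  \<open>v\<close> in the sample forces a positive answer for each of its bit values, so
  \<open>u\<close> shares all its bits and equals \<open>u'\<close>. Conversely a unique neighbour
  determines every answer.\<close>

lemma found_eq_hooks:
  assumes res: "\<And>a. a < (t + 2) * (2 * t) \<Longrightarrow>
      res a - test_set n t E s a = neighbours n w (test_set n t E s a)"
    and n: "n \<le> 2 ^ t" and t: "0 < t"
  shows "found n t E s res = hooks n w t E s"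
proof -
  have "(u \<in> sample n E s i \<and>
       (\<forall>a<(t + 2) * (2 * t). a div (2 * t) = i \<longrightarrow> (v \<in> res a \<longleftrightarrow> u \<in> test_set n t E s a))) \<longleftrightarrow>
     {u' \<in> sample n E s i. {u', v} \<in> edges n w} = {u}" (is "?L \<longleftrightarrow> ?R")
    if v: "v < n" "v \<notin> red n E s" and i: "i < t + 2" for u v i
  proof -
    have r: "v \<in> res a \<longleftrightarrow> (\<exists>u'\<in>test_set n t E s a. {u', v} \<in> edges n w)" if "a < (t + 2) * (2 * t)" for a
    proof -
      have nt: "v \<notin> test_set n t E s a"
        using v test_set_subset[of n t E s a] sample_subset_red[of n E s "a div (2 * t)"] by blast
      then have "v \<in> res a \<longleftrightarrow> v \<in> res a - test_set n t E s a" by simp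
      then show ?thesis using nt v(1) unfolding res[OF that] by (simp add: neighbours_def)
    qed
    show ?thesis
    proof
      assume L: ?L
      have uniq: "u' = u" if u': "u' \<in> sample n E s i" "{u', v} \<in> edges n w" for u'
      proof -
        have lt: "u < 2 ^ t" "u' < 2 ^ t"
          using L u' n sample_subset_red[of n E s i] red_subset[of n E s] by (auto intro: less_le_trans)
        have "bit u' j = bit u j" if j: "j < t" for j
        proof (rule ccontr)
          assume "bit u' j \<noteq> bit u j"
          obtain a where a: "a < (t + 2) * (2 * t)" "a div (2 * t) = i"
            "test_set n t E s a = {u \<in> sample n E s i. bit u j = bit u' j}"
            by (rule exists_test[OF i j])
          then have "v \<in> res a" using u' by (auto simp: r)
          then have "u \<in> test_set n t E s a" using L a by simp
          then show False using a(3) \<open>bit u' j \<noteq> bit u j\<close> by simp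
        qed
        then have "take_bit t u' = take_bit t u" by (intro bit_eqI) (auto simp: bit_take_bit_iff)
        then show ?thesis using lt by (simp add: take_bit_nat_eq_self)
      qed
      \<comment> \<open>Uniqueness alone allows no neighbour at all. A test set containing
        \<open>u\<close> gets a positive answer, which provides one; \<open>t > 0\<close> supplies
        the bit 0 used for it.\<close>
      obtain a where a: "a < (t + 2) * (2 * t)" "a div (2 * t) = i"
        "test_set n t E s a = {u' \<in> sample n E s i. bit u' 0 = bit u 0}"
        by (rule exists_test[OF i t])
      then have "v \<in> res a" using L by auto
      then obtain u' where u': "u' \<in> sample n E s i" "{u', v} \<in> edges n w"
        using r[OF a(1)] a(3) by auto
      then have "{u, v} \<in> edges n w" using uniq by metis
      then show ?R using L uniq by blast
    next
      assume R: ?R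
      then have u: "u \<in> sample n E s i" "{u, v} \<in> edges n w"
        and uniq: "\<And>u'. u' \<in> sample n E s i \<Longrightarrow> {u', v} \<in> edges n w \<Longrightarrow> u' = u" by blast+
      have "v \<in> res a \<longleftrightarrow> u \<in> test_set n t E s a" if a: "a < (t + 2) * (2 * t)" "a div (2 * t) = i" for a
      proof -
        have "test_set n t E s a \<subseteq> sample n E s i" using test_set_subset[of n t E s a] a(2) by simp
        then show ?thesis using r[OF a(1)] u(2) uniq by blast
      qed
      then show ?L using u(1) by blast
    qed
  qed
  then show ?thesis unfolding found_def hooks_def by (intro Collect_cong ex_cong1 conj_cong) auto
qed

section \<open>Isolation and the expected progress of one round\<close>

section \<open>Success probability of a round\<close>

text \<open>Second moment argument at the rate where the expected number x of survivors lies between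
  1/4 and 1/2. Pairwise independence bounds the second moment by x^2 + x, and 2 m - m^2 is at most
  the indicator of m = 1, so the probability is at least x - x^2 >= 3/16.\<close>

lemma isolation:
  fixes n t :: nat
  assumes N: "N \<subseteq> {..<n}" "N \<noteq> {}" and n: "n \<le> 2 ^ t"
  defines "D \<equiv> n * (t + 1)"
  shows "\<exists>i<t + 2. 3 / 16 * 2 ^ D \<le> real (card {h::nat. h < 2 ^ D \<and> (\<exists>u. {u \<in> N. \<forall>l<i. bit h (l * n + u)} = {u})})"
proof -
  define k where "k = card N"
  have fN: "finite N" using N finite_subset by blast
  have k: "1 \<le> k" "k \<le> 2 ^ t"
    using N fN n card_mono[of "{..<n}" N] by (auto simp: k_def Suc_le_eq card_gt_0_iff)
  \<comment> \<open>The rounded-up binary logarithm of the size of \<open>N\<close>; one halving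
    more brings the expectation to at most 1/2.\<close>
  define e where "e = (LEAST e. k \<le> 2 ^ e)"
  have e: "k \<le> 2 ^ e" "e \<le> t" unfolding e_def using k(2) by (auto intro: LeastI Least_le)
  have e2: "2 ^ e \<le> 2 * k"
  proof (cases e)
    case (Suc e')
    then have "\<not> k \<le> 2 ^ e'" using not_less_Least[of e' "\<lambda>e. k \<le> 2 ^ e"] by (simp add: e_def)
    then show ?thesis using Suc by simp
  qed (use k in simp)
  define i where "i = Suc e"
  define H where "H = {h::nat. h < 2 ^ D}"
  define A where "A u h \<longleftrightarrow> (\<forall>l<i. bit h (l * n + u))" for u h :: nat
  define q :: real where "q = 1 / 2 ^ i"
  have inj: "inj_on (\<lambda>l. l * n + u) {..<i}" if "u \<in> N" for u
    using that N by (auto simp: inj_on_def)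
  have sub: "(\<lambda>l. l * n + u) ` {..<i} \<subseteq> {..<D}" if "u \<in> N" for u
  proof clarify
    fix l assume "l < i"
    then have "l * n + u < Suc l * n" "Suc l \<le> t + 1" using that N e by (auto simp: i_def)
    moreover have "Suc l * n \<le> (t + 1) * n" using calculation(2) by (intro mult_right_mono) auto
    ultimately have "l * n + u < (t + 1) * n" by linarith
    then show "l * n + u < D" by (simp add: D_def mult.commute)
  qed
  have fin: "finite H" by (simp add: H_def)
  have one: "real (card {h\<in>H. A u h}) = 2 ^ D * q" if u: "u \<in> N" for u
  proof -
    have "{h\<in>H. A u h} = {h::nat. h < 2 ^ D \<and> (\<forall>p\<in>(\<lambda>l. l * n + u) ` {..<i}. bit h p = True)}"
      by (auto simp: H_def A_def)
    then have "card {h\<in>H. A u h} * 2 ^ i = 2 ^ D"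
      using card_prescribed_bits[OF _ sub[OF u], of "\<lambda>_. True"] by (simp add: card_image inj[OF u])
    from arg_cong[OF this, of real] show ?thesis by (simp add: q_def field_simps)
  qed
  have two: "real (card {h\<in>H. A u h \<and> A u' h}) = 2 ^ D * q\<^sup>2" if u: "u \<in> N" "u' \<in> N" "u \<noteq> u'" for u u'
  proof -
    let ?P = "\<lambda>u. (\<lambda>l. l * n + u) ` {..<i}"
    have "l * n + u \<noteq> l' * n + u'" for l l'
    proof
      assume "l * n + u = l' * n + u'"
      then have "(l * n + u) mod n = (l' * n + u') mod n" by simp
      moreover have "u < n" "u' < n" using u N by auto
      ultimately show False using u(3) by simp
    qed
    then have "?P u \<inter> ?P u' = {}" by auto
    then have c: "card (?P u \<union> ?P u') = 2 * i"
      by (simp add: card_Un_disjoint card_image inj u)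
    have "{h\<in>H. A u h \<and> A u' h} = {h::nat. h < 2 ^ D \<and> (\<forall>p\<in>?P u \<union> ?P u'. bit h p = True)}"
      by (auto simp: H_def A_def)
    then have "card {h\<in>H. A u h \<and> A u' h} * 2 ^ (2 * i) = 2 ^ D"
      using card_prescribed_bits[of "?P u \<union> ?P u'" D "\<lambda>_. True"] sub[OF u(1)] sub[OF u(2)]
      unfolding c by simp
    from arg_cong[OF this, of real] show ?thesis
      by (simp add: q_def field_simps flip: power_mult)
  qed
  define m where "m h = card {u\<in>N. A u h}" for h
  have m: "real (m h) = (\<Sum>u\<in>N. of_bool (A u h))" for h
    using fN by (simp add: m_def of_bool_def sum.If_cases Int_def)
  have "(\<Sum>h\<in>H. real (m h)) = (\<Sum>u\<in>N. \<Sum>h\<in>H. of_bool (A u h))"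
    unfolding m by (rule sum.swap)
  also have "\<dots> = (\<Sum>u\<in>N. real (card {h\<in>H. A u h}))"
    using fin by (simp add: of_bool_def sum.If_cases Int_def)
  finally have s1: "(\<Sum>h\<in>H. real (m h)) = real k * (2 ^ D * q)"
    by (simp add: one k_def)
  have "(\<Sum>h\<in>H. (real (m h))\<^sup>2) = (\<Sum>h\<in>H. \<Sum>u\<in>N. \<Sum>u'\<in>N. of_bool (A u h \<and> A u' h))"
    unfolding m power2_eq_square sum_product by (simp add: of_bool_conj)
  also have "\<dots> = (\<Sum>u\<in>N. \<Sum>u'\<in>N. \<Sum>h\<in>H. of_bool (A u h \<and> A u' h))"
    by (subst sum.swap, rule sum.cong[OF refl], rule sum.swap)
  also have "\<dots> = (\<Sum>u\<in>N. \<Sum>u'\<in>N. real (card {h\<in>H. A u h \<and> A u' h}))"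
    using fin by (simp add: of_bool_def sum.If_cases Int_def)
  \<comment> \<open>The diagonal terms have probability \<open>q\<close>, all others
    \<open>q^2\<close> by pairwise independence.\<close>
  also have "\<dots> = (\<Sum>u\<in>N. \<Sum>u'\<in>N. 2 ^ D * q\<^sup>2 + (if u' = u then 2 ^ D * q - 2 ^ D * q\<^sup>2 else 0))"
    using two one by (intro sum.cong refl) auto
  also have "\<dots> = real k * (real k * (2 ^ D * q\<^sup>2) + (2 ^ D * q - 2 ^ D * q\<^sup>2))"
    using fN by (simp add: sum.distrib sum.delta k_def)
  finally have s2: "(\<Sum>h\<in>H. (real (m h))\<^sup>2) = real k * (real k * (2 ^ D * q\<^sup>2) + (2 ^ D * q - 2 ^ D * q\<^sup>2))" .
  let ?x = "real k * q"
  have x: "1 / 4 \<le> ?x" "?x \<le> 1 / 2"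
  proof -
    have "real k \<le> 2 ^ e" "2 ^ e \<le> 2 * real k"
      using of_nat_mono[OF e(1), where 'a=real] of_nat_mono[OF e2, where 'a=real] by auto
    then show "1 / 4 \<le> ?x" "?x \<le> 1 / 2" by (auto simp: q_def i_def field_simps)
  qed
  \<comment> \<open>The product expands to \<open>x - x^2 - 3/16\<close>.\<close>
  have "0 \<le> (?x - 1 / 4) * (3 / 4 - ?x)" using x by (intro mult_nonneg_nonneg) auto
  then have "3 / 16 \<le> ?x - ?x\<^sup>2" by (simp add: power2_eq_square algebra_simps)
  also have "\<dots> \<le> ?x - ?x\<^sup>2 + real k * q\<^sup>2" by simp
  finally have "3 / 16 * 2 ^ D \<le> (?x - ?x\<^sup>2 + real k * q\<^sup>2) * 2 ^ D" by (intro mult_right_mono) auto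
  also have "\<dots> = 2 * (\<Sum>h\<in>H. real (m h)) - (\<Sum>h\<in>H. (real (m h))\<^sup>2)"
    unfolding s1 s2 by (simp add: power2_eq_square algebra_simps)
  also have "\<dots> = (\<Sum>h\<in>H. 2 * real (m h) - (real (m h))\<^sup>2)"
    by (simp add: sum_subtractf sum_distrib_left)
  also have "\<dots> \<le> (\<Sum>h\<in>H. of_bool (m h = 1))"
  proof (rule sum_mono)
    fix h
    show "2 * real (m h) - (real (m h))\<^sup>2 \<le> of_bool (m h = 1)"
    proof (cases "2 \<le> m h")
      case True
      then have "2 * real (m h) \<le> real (m h) * real (m h)" by (intro mult_right_mono) auto
      then show ?thesis by (simp add: power2_eq_square)
    next
      case False
      then have "m h = 0 \<or> m h = 1" by auto
      then show ?thesis by auto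
    qed
  qed
  also have "\<dots> = real (card {h\<in>H. m h = 1})"
    using fin by (simp add: of_bool_def sum.If_cases Int_def)
  also have "{h\<in>H. m h = 1} = {h::nat. h < 2 ^ D \<and> (\<exists>u. {u \<in> N. \<forall>l<i. bit h (l * n + u)} = {u})}"
    unfolding m_def A_def H_def by (auto simp: card_1_singleton_iff)
  finally have "3 / 16 * 2 ^ D \<le> real (card {h::nat. h < 2 ^ D \<and> (\<exists>u. {u \<in> N. \<forall>l<i. bit h (l * n + u)} = {u})})" .
  moreover have "i < t + 2" using e by (simp add: i_def)
  ultimately show ?thesis by blast
qed

lemma bit_append:
  assumes "(c::nat) < 2 ^ n"
  shows "bit (c + 2 ^ n * h) p \<longleftrightarrow> (if p < n then bit c p else bit h (p - n))"
proof -
  have t: "take_bit n (c + 2 ^ n * h) = c" using assms by (simp add: take_bit_eq_mod)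
  have d: "drop_bit n (c + 2 ^ n * h) = h" using assms by (simp add: drop_bit_eq_div)
  show ?thesis
  proof (cases "p < n")
    case True
    then show ?thesis using t by (metis bit_take_bit_iff)
  next
    case False
    then have "bit (drop_bit n (c + 2 ^ n * h)) (p - n) = bit (c + 2 ^ n * h) p"
      by (simp add: bit_drop_bit_eq)
    then show ?thesis using d False by simp
  qed
qed

text \<open>The two components get the colours red and blue with probability 1/4. Then
  \<open>u\<close> makes the set of red neighbours of \<open>v\<close> nonempty, and the independent
  halvings isolate one of them with probability 3/16.\<close>

lemma hook_probability:
  assumes uv: "u < n" "v < n" "{u, v} \<in> edges n w" "component_of n E u \<noteq> component_of n E v"
    and n: "n \<le> 2 ^ t"
  shows "3 / 64 * 2 ^ (n * (t + 2)) \<le> real (card {s. s < 2 ^ (n * (t + 2)) \<and> v \<notin> red n E s \<and>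
     (\<exists>i<t + 2. \<exists>u'. {u' \<in> sample n E s i. {u', v} \<in> edges n w} = {u'})})"
    (is "_ \<le> real (card ?G)")
proof -
  define D where "D = n * (t + 1)"
  let ?lu = "component_label n E u" and ?lv = "component_label n E v"
  have l: "?lu < n" "?lv < n" "?lu \<noteq> ?lv"
    using component_label_mem uv component_label_eq_iff[of u n v E] by auto
  define GC where "GC = {c::nat. c < 2 ^ n \<and> bit c ?lu \<and> \<not> bit c ?lv}"
  have "GC = {c. c < 2 ^ n \<and> (\<forall>p\<in>{?lu, ?lv}. bit c p = (p = ?lu))}"
    using l by (auto simp: GC_def)
  then have "card GC * 4 = 2 ^ n"
    using card_prescribed_bits[of "{?lu, ?lv}" n "\<lambda>p. p = ?lu"] l by simp
  from arg_cong[OF this, of real] have GC: "real (card GC) = 2 ^ n / 4" by simp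
  define N where "N c = {u' \<in> red n E c. {u', v} \<in> edges n w}" for c
  define J where "J c i = {h::nat. h < 2 ^ D \<and> (\<exists>u. {u \<in> N c. \<forall>l<i. bit h (l * n + u)} = {u})}" for c i
  have "\<exists>i. i < t + 2 \<and> 3 / 16 * 2 ^ D \<le> real (card (J c i))" if "c \<in> GC" for c
    unfolding D_def J_def using that uv
    by (intro isolation[OF _ _ n]) (auto simp: N_def GC_def red_def)
  then have "\<forall>c\<in>GC. \<exists>i. i < t + 2 \<and> 3 / 16 * 2 ^ D \<le> real (card (J c i))" by blast
  \<comment> \<open>The best rate depends on the colouring \<open>c\<close>, so good seeds are
    counted over a dependent sum.\<close>
  from bchoice[OF this] obtain I where *: "\<forall>c\<in>GC. I c < t + 2 \<and> 3 / 16 * 2 ^ D \<le> real (card (J c (I c)))" ..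
  have I: "I c < t + 2" "3 / 16 * 2 ^ D \<le> real (card (J c (I c)))" if "c \<in> GC" for c
    using bspec[OF * that] by auto
  define GH where "GH c = J c (I c)" for c
  let ?f = "\<lambda>(c, h). c + 2 ^ n * h :: nat"
  have dm: "(c + 2 ^ n * h) mod 2 ^ n = c" "(c + 2 ^ n * h) div 2 ^ n = h" if "c < 2 ^ n" for c h :: nat
    using that by auto
  have inj: "inj_on ?f (Sigma GC GH)"
  proof (rule inj_onI, clarify)
    fix c h c' h' assume "c \<in> GC" "c' \<in> GC" and eq: "c + 2 ^ n * h = c' + 2 ^ n * h'"
    then have "c < 2 ^ n" "c' < 2 ^ n" by (simp_all add: GC_def)
    note dm = dm[OF this(1), of h, unfolded eq] dm[OF this(2), of h']
    show "c = c' \<and> h = h'" by (rule conjI; rule trans[OF sym]; rule dm)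
  qed
  have "?f ` Sigma GC GH \<subseteq> ?G"
  proof clarify
    fix c h assume c: "c \<in> GC" and h: "h \<in> GH c"
    let ?s = "c + 2 ^ n * h"
    have c': "c < 2 ^ n" and h': "h < 2 ^ D" using c h by (auto simp: GC_def GH_def J_def)
    have "?s < 2 ^ n * Suc h" using c' by simp
    also have "\<dots> \<le> 2 ^ n * 2 ^ D" using h' by (intro mult_left_mono) auto
    also have "\<dots> = 2 ^ (n * (t + 2))" by (simp add: D_def flip: power_add)
    finally have lt: "?s < 2 ^ (n * (t + 2))" .
    have red: "red n E ?s = red n E c"
      using component_label_mem(2) by (auto simp: red_def bit_append[OF c'])
    have "sample n E ?s i = {u \<in> red n E c. \<forall>l<i. bit h (l * n + u)}" for i
      unfolding sample_def red by (simp add: bit_append[OF c'])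
    then have "{u' \<in> sample n E ?s (I c). {u', v} \<in> edges n w} = {u \<in> N c. \<forall>l<I c. bit h (l * n + u)}"
      by (auto simp: N_def)
    moreover obtain u' where "{u \<in> N c. \<forall>l<I c. bit h (l * n + u)} = {u'}" using h by (auto simp: GH_def J_def)
    ultimately have "{u' \<in> sample n E ?s (I c). {u', v} \<in> edges n w} = {u'}" by simp
    moreover have "v \<notin> red n E ?s" unfolding red using c by (auto simp: red_def GC_def)
    ultimately show "?s < 2 ^ (n * (t + 2)) \<and> v \<notin> red n E ?s \<and>
      (\<exists>i<t + 2. \<exists>u'. {u' \<in> sample n E ?s i. {u', v} \<in> edges n w} = {u'})"
      using lt I(1)[OF c] by blast
  qed
  then have "card (?f ` Sigma GC GH) \<le> card ?G" by (intro card_mono) auto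
  moreover have "card (?f ` Sigma GC GH) = (\<Sum>c\<in>GC. card (GH c))"
    using inj by (subst card_image) (auto simp: GC_def GH_def J_def)
  ultimately have "(\<Sum>c\<in>GC. card (GH c)) \<le> card ?G" by simp
  from of_nat_mono[OF this, where 'a=real] have "(\<Sum>c\<in>GC. real (card (GH c))) \<le> real (card ?G)"
    by simp
  moreover have "(\<Sum>c\<in>GC. 3 / 16 * 2 ^ D) \<le> (\<Sum>c\<in>GC. real (card (GH c)))"
    using I(2) by (intro sum_mono) (simp add: GH_def)
  moreover have "(\<Sum>c\<in>GC. 3 / 16 * 2 ^ D) = 3 / 64 * (2 ^ n * 2 ^ D :: real)"
    by (simp add: GC)
  moreover have "(2 ^ n * 2 ^ D :: real) = 2 ^ (n * (t + 2))"
    by (simp add: D_def flip: power_add)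
  ultimately show ?thesis by linarith
qed


text \<open>If no edge left \<open>X\<close>, no path could leave it either, and \<open>X\<close>
  would be a component of the whole graph.\<close>

lemma exists_leaving_edge:
  assumes E: "E \<subseteq> edges n w" and X: "X \<in> components n E" "X \<notin> components n (edges n w)"
  shows "\<exists>u v. u < n \<and> v < n \<and> {u, v} \<in> edges n w \<and> X = component_of n E v \<and> component_of n E u \<noteq> X"
proof (rule ccontr)
  assume none: "\<not> ?thesis"
  obtain x where x: "x < n" "X = component_of n E x" using X by (auto simp: components_eq_image)
  have "component_of n E x = component_of n (edges n w) x"
  proof
    show "component_of n E x \<subseteq> component_of n (edges n w) x"
      using connected_in_mono[OF E, of n] by (auto simp: mem_component_of)
    show "component_of n (edges n w) x \<subseteq> component_of n E x"
    proof
      fix y assume "y \<in> component_of n (edges n w) x"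
      then have "(x, y) \<in> {(u, v). {u, v} \<in> edges n w}\<^sup>*" by (auto simp: mem_component_of connected_in_iff)
      then have "y < n \<and> component_of n E y = X"
      proof (induction rule: rtrancl_induct)
        case (step y z)
        then have yz: "{z, y} \<in> edges n w" by (auto simp: insert_commute)
        then have "z < n" by (auto simp: edges_def vertex_pairs_def)
        then show ?case using none yz step.IH by metis
      qed (use x in auto)
      then show "y \<in> component_of n E x" using component_of_self[of y n E] x by simp
    qed
  qed
  then show False using X x by (auto simp: components_eq_image)
qed

lemma connected_in_red:
  assumes "(u, v) \<in> connected_in n E" "u \<in> red n E s"
  shows "v \<in> red n E s"
proof -
  have uv: "u < n" "v < n" using assms(1) by (auto simp: connected_in_iff)
  then have "component_label n E u = component_label n E v"
    using assms(1) by (simp add: component_label_eq_iff component_of_eq_iff)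
  then show ?thesis using assms(2) uv by (simp add: red_def)
qed

text \<open>Every component that is not final has a vertex that is hooked with probability at least
  3/64, and there are at least as many such components as the excess over the final count. Linearity
  of expectation then gives the factor 61/64.\<close>

lemma expected_components:
  assumes E: "E \<subseteq> edges n w" and n: "n \<le> 2 ^ t"
  defines "B \<equiv> 2 ^ (n * (t + 2))" and "c \<equiv> \<lambda>E. real (card (components n E))"
  shows "(\<Sum>s<B. c (E \<union> hooks n w t E s) - c (edges n w)) \<le> 61 / 64 * real B * (c E - c (edges n w))"
proof -
  define Act where "Act = components n E - components n (edges n w)"
  define U where "U v s \<longleftrightarrow> v \<notin> red n E s \<and>
     (\<exists>i<t + 2. \<exists>u'. {u' \<in> sample n E s i. {u', v} \<in> edges n w} = {u'})" for v s
  have fin: "finite Act" by (simp add: Act_def)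
  have "\<forall>X\<in>Act. \<exists>v. v < n \<and> X = component_of n E v \<and> 3 / 64 * real B \<le> real (card {s\<in>{..<B}. U v s})"
  proof
    fix X assume "X \<in> Act"
    then obtain u v where uv: "u < n" "v < n" "{u, v} \<in> edges n w" "X = component_of n E v"
      "component_of n E u \<noteq> X" using exists_leaving_edge[OF E, of X] by (auto simp: Act_def)
    have "{s\<in>{..<B}. U v s} = {s. s < B \<and> U v s}" by auto
    then have "3 / 64 * real B \<le> real (card {s\<in>{..<B}. U v s})"
      using hook_probability[OF uv(1-3) _ n, of E] uv(4,5) by (simp add: B_def U_def)
    then show "\<exists>v. v < n \<and> X = component_of n E v \<and> 3 / 64 * real B \<le> real (card {s\<in>{..<B}. U v s})"
      using uv by blast
  qed
  from bchoice[OF this] obtain V where V': "\<forall>X\<in>Act. V X < n \<and> X = component_of n E (V X) \<and>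
    3 / 64 * real B \<le> real (card {s\<in>{..<B}. U (V X) s})" ..
  have V: "V X < n" "X = component_of n E (V X)" "3 / 64 * real B \<le> real (card {s\<in>{..<B}. U (V X) s})"
    if "X \<in> Act" for X using bspec[OF V' that] by blast+
  have step: "c (E \<union> hooks n w t E s) + real (card {X\<in>Act. U (V X) s}) \<le> c E" for s
  proof -
    let ?E' = "E \<union> hooks n w t E s" and ?R = "red n E s"
    let ?JB = "component_of n E ` {v. v < n \<and> v \<notin> ?R \<and> (\<exists>u\<in>?R. u < n \<and> {u, v} \<in> ?E')}"
    have "{X\<in>Act. U (V X) s} \<subseteq> ?JB"
    proof clarify
      fix X assume X: "X \<in> Act" "U (V X) s"
      then obtain i u where i: "i < t + 2" and u: "{u' \<in> sample n E s i. {u', V X} \<in> edges n w} = {u}"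
        and red: "V X \<notin> ?R" by (auto simp: U_def)
      have "u \<in> sample n E s i" using u by blast
      then have "u \<in> ?R" "u < n" using sample_subset_red red_subset by blast+
      moreover have "{u, V X} \<in> hooks n w t E s"
        using i u red V(1)[OF X(1)] by (auto simp: hooks_def)
      ultimately have "component_of n E (V X) \<in> ?JB" using red V(1)[OF X(1)] by blast
      then show "X \<in> ?JB" using V(2)[OF X(1)] by simp
    qed
    then have "card {X\<in>Act. U (V X) s} \<le> card ?JB" by (intro card_mono) auto
    moreover have "card (components n ?E') + card ?JB \<le> card (components n E)"
      by (rule card_components_hook) (auto intro: connected_in_red)
    ultimately have "card (components n ?E') + card {X\<in>Act. U (V X) s} \<le> card (components n E)" by simp
    from of_nat_mono[OF this, where 'a=real] show ?thesis by (simp add: c_def)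
  qed
  have "(\<Sum>s<B. real (card {X\<in>Act. U (V X) s})) = (\<Sum>s<B. \<Sum>X\<in>Act. of_bool (U (V X) s))"
    using fin by (simp add: of_bool_def sum.If_cases Int_def)
  also have "\<dots> = (\<Sum>X\<in>Act. \<Sum>s<B. of_bool (U (V X) s))" by (rule sum.swap)
  also have "\<dots> = (\<Sum>X\<in>Act. real (card {s\<in>{..<B}. U (V X) s}))"
    by (simp add: of_bool_def sum.If_cases Int_def)
  also have "\<dots> \<ge> (\<Sum>X\<in>Act. 3 / 64 * real B)" using V(3) by (intro sum_mono)
  finally have joined: "3 / 64 * real B * real (card Act) \<le> (\<Sum>s<B. real (card {X\<in>Act. U (V X) s}))"
    by (simp add: mult.commute)
  have "card (components n E) - card (components n (edges n w)) \<le> card Act"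
    unfolding Act_def by (rule diff_card_le_card_Diff) simp
  then have "c E - c (edges n w) \<le> real (card Act)" by (simp add: c_def)
  then have "3 / 64 * real B * (c E - c (edges n w)) \<le> 3 / 64 * real B * real (card Act)"
    by (intro mult_left_mono) auto
  moreover have "(\<Sum>s<B. c (E \<union> hooks n w t E s) - c (edges n w)) \<le>
      (\<Sum>s<B. (c E - c (edges n w)) - real (card {X\<in>Act. U (V X) s}))"
  proof (rule sum_mono)
    fix s
    show "c (E \<union> hooks n w t E s) - c (edges n w) \<le> (c E - c (edges n w)) - real (card {X\<in>Act. U (V X) s})"
      using step[of s] by linarith
  qed
  moreover have "\<dots> = real B * (c E - c (edges n w)) - (\<Sum>s<B. real (card {X\<in>Act. U (V X) s}))"
    by (simp add: sum_subtractf)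
  moreover have "real B * (c E - c (edges n w)) - 3 / 64 * real B * (c E - c (edges n w)) =
    61 / 64 * real B * (c E - c (edges n w))" by (simp add: field_simps)
  ultimately show ?thesis using joined by linarith
qed

section \<open>Iterated rounds and Markov's inequality\<close>

section \<open>Repeating the rounds\<close>

text \<open>Digit \<open>k\<close> of the whole seed in base \<open>2 ^ (n * (t + 2))\<close>, so
  the rounds have independent seeds.\<close>

definition round_seed :: "nat \<Rightarrow> nat \<Rightarrow> nat \<Rightarrow> nat \<Rightarrow> nat" where
  "round_seed n t r k = r div (2 ^ (n * (t + 2))) ^ k mod 2 ^ (n * (t + 2))"

text \<open>The run with truthful answers, which depends on the seed and \<open>w\<close>
  only.\<close>

fun grow :: "nat \<Rightarrow> (nat set \<Rightarrow> int) \<Rightarrow> nat \<Rightarrow> nat \<Rightarrow> nat \<Rightarrow> nat set set" where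
  "grow n w t r 0 = {}"
| "grow n w t r (Suc k) = grow n w t r k \<union> hooks n w t (grow n w t r k) (round_seed n t r k)"

lemma grow_subset: "grow n w t r k \<subseteq> edges n w"
  by (induction k) (auto simp: hooks_subset[THEN subsetD])

lemma round_seed_append:
  fixes n t :: nat
  defines "B \<equiv> 2 ^ (n * (t + 2))"
  shows "j < k \<Longrightarrow> round_seed n t (s * B ^ k + r) j = round_seed n t r j"
    and "s < B \<Longrightarrow> r < B ^ k \<Longrightarrow> round_seed n t (s * B ^ k + r) k = s"
proof -
  have B: "0 < B" by (simp add: B_def)
  show "round_seed n t (s * B ^ k + r) j = round_seed n t r j" if j: "j < k"
  proof -
    obtain d where "k = Suc (j + d)" using less_imp_Suc_add[OF j] by blast
    then have eq: "s * B ^ k + r = r + (s * B ^ d * B) * B ^ j"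
      by (simp add: power_add mult_ac)
    have "(s * B ^ k + r) div B ^ j = s * B ^ d * B + r div B ^ j"
      unfolding eq using B by simp
    then show ?thesis unfolding round_seed_def B_def[symmetric] by simp
  qed
  show "round_seed n t (s * B ^ k + r) k = s" if "s < B" "r < B ^ k"
    using that B unfolding round_seed_def B_def[symmetric] by simp
qed

lemma grow_append: "j \<le> k \<Longrightarrow> grow n w t (s * (2 ^ (n * (t + 2))) ^ k + r) j = grow n w t r j"
proof (induction j)
  case (Suc j)
  have "round_seed n t (s * (2 ^ (n * (t + 2))) ^ k + r) j = round_seed n t r j"
    using Suc.prems by (intro round_seed_append(1)) simp
  then show ?case using Suc by (simp only: grow.simps Suc_leD)
qed simp

lemma card_components_le: "card (components n E) \<le> n"
  using card_image_le[of "{..<n}" "component_of n E"] by (simp add: components_eq_image)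

text \<open>The top digit of the seed drives the last round and does not influence the earlier ones,
  so the one-round bound can be applied for each fixed choice of the lower digits.\<close>

lemma expected_components_grow:
  assumes n: "n \<le> 2 ^ t"
  defines "B \<equiv> 2 ^ (n * (t + 2))" and "c \<equiv> \<lambda>E. real (card (components n E))"
  shows "(\<Sum>r<B ^ k. c (grow n w t r k) - c (edges n w)) \<le> real n * (61 / 64 * real B) ^ k"
proof (induction k)
  case 0
  show ?case using card_components_le[of n "{}"] by (simp add: c_def)
next
  case (Suc k)
  let ?g = "\<lambda>k r. c (grow n w t r k) - c (edges n w)"
  have "(\<Sum>r<B ^ Suc k. ?g (Suc k) r) = (\<Sum>s<B. \<Sum>r = s * B ^ k..<s * B ^ k + B ^ k. ?g (Suc k) r)"
    by (simp add: sum.nat_group)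
  also have "\<dots> = (\<Sum>s<B. \<Sum>r<B ^ k. ?g (Suc k) (s * B ^ k + r))"
  proof (rule sum.cong[OF refl])
    fix s
    show "(\<Sum>r = s * B ^ k..<s * B ^ k + B ^ k. ?g (Suc k) r) = (\<Sum>r<B ^ k. ?g (Suc k) (s * B ^ k + r))"
      using sum.shift_bounds_nat_ivl[of "?g (Suc k)" 0 "s * B ^ k" "B ^ k"]
      by (simp only: add_0 atLeast0LessThan add.commute)
  qed
  also have "\<dots> = (\<Sum>s<B. \<Sum>r<B ^ k. c (grow n w t r k \<union> hooks n w t (grow n w t r k) s) - c (edges n w))"
  proof (intro sum.cong refl)
    fix s r assume "s \<in> {..<B}" "r \<in> {..<B ^ k}"
    then have "s < B" "r < B ^ k" by simp_all
    then have "round_seed n t (s * B ^ k + r) k = s"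
      unfolding B_def by (rule round_seed_append(2))
    moreover have "grow n w t (s * B ^ k + r) k = grow n w t r k"
      unfolding B_def by (rule grow_append) simp
    ultimately show "?g (Suc k) (s * B ^ k + r) =
        c (grow n w t r k \<union> hooks n w t (grow n w t r k) s) - c (edges n w)"
      by (simp only: grow.simps)
  qed
  also have "\<dots> = (\<Sum>r<B ^ k. \<Sum>s<B. c (grow n w t r k \<union> hooks n w t (grow n w t r k) s) - c (edges n w))"
    by (rule sum.swap)
  also have "\<dots> \<le> (\<Sum>r<B ^ k. 61 / 64 * real B * ?g k r)"
    unfolding B_def c_def by (intro sum_mono expected_components[OF grow_subset n])
  also have "\<dots> = 61 / 64 * real B * (\<Sum>r<B ^ k. ?g k r)" by (simp add: sum_distrib_left)
  also have "\<dots> \<le> 61 / 64 * real B * (real n * (61 / 64 * real B) ^ k)"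
    using Suc by (intro mult_left_mono) auto
  finally show ?case by (simp add: mult_ac)
qed

text \<open>Failure means an integer excess of at least 1, so its probability is at most the
  expected excess. Fifteen rounds at least halve the bound, and \<open>t + 6\<close> such halvings
  bring \<open>n\<close> down to at most 1/64 < 1/50.\<close>

lemma grow_success:
  assumes n: "n \<le> 2 ^ t"
  defines "B \<equiv> 2 ^ (n * (t + 2))" and "m \<equiv> 15 * (t + 6)"
  shows "49 / 50 * real (B ^ m) \<le>
    real (card {r. r < B ^ m \<and> components n (grow n w t r m) = components n (edges n w)})"
proof -
  let ?c = "\<lambda>E. card (components n E)"
  define G where "G = {r. r < B ^ m \<and> components n (grow n w t r m) = components n (edges n w)}"
  have ge: "?c (edges n w) \<le> ?c (grow n w t r m)" for r
    using card_image_le[OF finite_components] components_image[OF grow_subset] by metis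
  have "real (card ({..<B ^ m} - G)) = (\<Sum>r\<in>{..<B ^ m} - G. 1)" by simp
  also have "\<dots> \<le> (\<Sum>r\<in>{..<B ^ m} - G. real (?c (grow n w t r m)) - real (?c (edges n w)))"
  proof (rule sum_mono)
    fix r assume "r \<in> {..<B ^ m} - G"
    then have "\<not> ?c (grow n w t r m) \<le> ?c (edges n w)"
      using components_eqI[OF grow_subset, of n n w t r m] by (auto simp: G_def)
    then have "?c (edges n w) + 1 \<le> ?c (grow n w t r m)" by simp
    from of_nat_mono[OF this, where 'a=real] show "1 \<le> real (?c (grow n w t r m)) - real (?c (edges n w))"
      by simp
  qed
  also have "\<dots> \<le> (\<Sum>r<B ^ m. real (?c (grow n w t r m)) - real (?c (edges n w)))"
    using ge by (intro sum_mono2) auto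
  also have "\<dots> \<le> real n * (61 / 64 * real B) ^ m"
    unfolding B_def by (rule expected_components_grow[OF n])
  also have "\<dots> = real n * ((61 / 64) ^ 15) ^ (t + 6) * real (B ^ m)"
    by (simp only: power_mult_distrib of_nat_power m_def power_mult mult.assoc)
  also have "\<dots> \<le> 2 ^ t * (1 / 2) ^ (t + 6) * real (B ^ m)"
  proof (intro mult_right_mono mult_mono power_mono)
    show "real n \<le> 2 ^ t" using of_nat_mono[OF n, where 'a=real] by simp
    show "(61 / 64 :: real) ^ 15 \<le> 1 / 2" by (simp add: power_divide)
  qed auto
  also have "2 ^ t * (1 / 2) ^ (t + 6) = (1 / 64 :: real)"
    by (simp add: power_add power_divide)
  finally have "real (card ({..<B ^ m} - G)) \<le> 1 / 64 * real (B ^ m)" .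
  moreover have "card ({..<B ^ m} - G) = B ^ m - card G"
    by (subst card_Diff_subset) (auto simp: G_def)
  moreover have "card G \<le> B ^ m" using card_mono[of "{..<B ^ m}" G] by (auto simp: G_def)
  ultimately have "real (B ^ m) - real (card G) \<le> 1 / 64 * real (B ^ m)"
    by (simp add: of_nat_diff)
  then have "49 / 50 * real (B ^ m) \<le> real (card G)"
    using of_nat_0_le_iff[of "B ^ m", where 'a=real] by linarith
  then show ?thesis by (simp add: G_def)
qed

section \<open>The rounds as an adaptive strategy of neighbour questions\<close>

text \<open>The counterpart of \<open>grow\<close> that is computed from the answers instead of
  \<open>w\<close>, round \<open>k\<close> reading the \<open>k\<close>-th batch of answers.\<close>

fun gather :: "nat \<Rightarrow> nat \<Rightarrow> nat \<Rightarrow> (nat \<Rightarrow> nat set) \<Rightarrow> nat \<Rightarrow> nat set set" where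
  "gather n t r res 0 = {}"
| "gather n t r res (Suc k) = gather n t r res k \<union>
    found n t (gather n t r res k) (round_seed n t r k) (\<lambda>a. res (k * ((t + 2) * (2 * t)) + a))"

lemma found_cong:
  assumes "\<And>a. a < (t + 2) * (2 * t) \<Longrightarrow> res a = res' a"
  shows "found n t E s res = found n t E s res'"
  using assms unfolding found_def by (intro Collect_cong ex_cong1 conj_cong) auto

lemma gather_cong:
  assumes "\<And>\<sigma>. \<sigma> < k * ((t + 2) * (2 * t)) \<Longrightarrow> res \<sigma> = res' \<sigma>"
  shows "gather n t r res k = gather n t r res' k"
  using assms
proof (induction k)
  case (Suc k)
  have "gather n t r res k = gather n t r res' k" using Suc by auto
  moreover have "found n t E s (\<lambda>a. res (k * ((t + 2) * (2 * t)) + a)) =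
    found n t E s (\<lambda>a. res' (k * ((t + 2) * (2 * t)) + a))" for E s
    using Suc.prems by (intro found_cong) auto
  ultimately show ?case by simp
qed simp

definition strategy :: "nat \<Rightarrow> nat \<Rightarrow> nat \<Rightarrow> nat \<Rightarrow> (nat \<Rightarrow> nat set) \<Rightarrow> nat set" where
  "strategy n t \<sigma> r res = (let N = (t + 2) * (2 * t); k = \<sigma> div N in
     test_set n t (gather n t r res k) (round_seed n t r k) (\<sigma> mod N))"

lemma strategy_cong:
  assumes "\<And>\<sigma>'. \<sigma>' < \<sigma> \<Longrightarrow> res \<sigma>' = res' \<sigma>'"
  shows "strategy n t \<sigma> r res = strategy n t \<sigma> r res'"
proof -
  let ?N = "(t + 2) * (2 * t)"
  have "gather n t r res (\<sigma> div ?N) = gather n t r res' (\<sigma> div ?N)"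
  proof (rule gather_cong)
    fix \<sigma>' assume "\<sigma>' < \<sigma> div ?N * ?N"
    also have "\<dots> \<le> \<sigma>" by (rule div_times_less_eq_dividend)
    finally show "res \<sigma>' = res' \<sigma>'" by (rule assms)
  qed
  then show ?thesis by (simp add: strategy_def Let_def)
qed

lemma strategy_subset: "strategy n t \<sigma> r res \<subseteq> {..<n}"
  unfolding strategy_def Let_def
  by (intro order_trans[OF test_set_subset] order_trans[OF sample_subset_red] red_subset)

text \<open>Truthful answers decode to exactly the hooks of each round, so by induction the next
  questions are also those of the ideal run.\<close>

lemma gather_eq_grow:
  assumes res: "\<And>\<sigma>. \<sigma> < m * ((t + 2) * (2 * t)) \<Longrightarrow>
      res \<sigma> - strategy n t \<sigma> r res = neighbours n w (strategy n t \<sigma> r res)"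
    and n: "n \<le> 2 ^ t" and t: "0 < t"
  shows "k \<le> m \<Longrightarrow> gather n t r res k = grow n w t r k"
proof (induction k)
  case (Suc k)
  let ?N = "(t + 2) * (2 * t)"
  have "found n t (grow n w t r k) (round_seed n t r k) (\<lambda>a. res (k * ?N + a)) =
    hooks n w t (grow n w t r k) (round_seed n t r k)"
  proof (rule found_eq_hooks[OF _ n t])
    fix a assume a: "a < ?N"
    have dm: "(k * N + a) div N = k" "(k * N + a) mod N = a" if "a < N" for N using that by auto
    have "(k * ?N + a) div ?N = k" "(k * ?N + a) mod ?N = a" by (rule dm[OF a])+
    then have "strategy n t (k * ?N + a) r res = test_set n t (grow n w t r k) (round_seed n t r k) a"
      using Suc by (simp only: strategy_def Let_def Suc_leD)
    moreover have "k * ?N + a < Suc k * ?N" using a by simp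
    moreover have "Suc k * ?N \<le> m * ?N" using Suc.prems by (intro mult_right_mono) auto
    ultimately show "res (k * ?N + a) - test_set n t (grow n w t r k) (round_seed n t r k) a =
      neighbours n w (test_set n t (grow n w t r k) (round_seed n t r k) a)"
      using res[of "k * ?N + a"] by simp
  qed
  then show ?case using Suc by simp
qed simp

lemma finite_edges: "finite (edges n w)"
proof -
  have "edges n w \<subseteq> Pow {..<n}" by (auto simp: edges_def vertex_pairs_def)
  then show ?thesis using finite_subset by blast
qed

lemma spanning_forest_algorithm:
  fixes n M t J :: nat
  assumes n: "0 < n" "n \<le> 2 ^ t" and t: "0 < t" and M: "0 < M" and J: "n * M \<le> 2 ^ J"
  obtains A :: "nat set set quantum_algorithm" where "valid_algorithm n M A"
    "num_queries A = 4 * (15 * (t + 6) * ((t + 2) * (2 * t)) * J)"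
    "\<And>w. w \<in> weight_functions n M \<Longrightarrow> 49 / 50 \<le> output_prob n M A w (spanning_forest n (edges n w))"
proof -
  define m where "m = 15 * (t + 6)"
  \<comment> \<open>Classical post-processing of the gathered graph; with truthful answers it is a
    subgraph of the input, and for good seeds it has the same components, so its spanning forests
    are those required.\<close>
  define out where "out r res = (SOME F. spanning_forest n (gather n t r res m) F)" for r res
  let ?Q = "m * ((t + 2) * (2 * t))" and ?L = "n * (t + 2) * m"
  obtain A where A: "valid_algorithm n M A" "num_queries A = 4 * (?Q * J)"
    "\<And>w P. w \<in> weight_functions n M \<Longrightarrow>
      real (card {r. r < 2 ^ ?L \<and> (\<forall>res. (\<forall>\<sigma><?Q. res \<sigma> - strategy n t \<sigma> r res =
        neighbours n w (strategy n t \<sigma> r res)) \<longrightarrow> P (out r res))}) / 2 ^ ?L \<le> output_prob n M A w P"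
    using adaptive_neighbour_tests[where S = "strategy n t" and Q = ?Q and Lr = ?L and out = out,
        OF n(1) M J strategy_cong strategy_subset] by blast
  show thesis
  proof (rule that[OF A(1)])
    show "num_queries A = 4 * (15 * (t + 6) * ((t + 2) * (2 * t)) * J)" using A(2) by (simp add: m_def)
    fix w assume w: "w \<in> weight_functions n M"
    let ?G = "{r. r < 2 ^ ?L \<and> (\<forall>res. (\<forall>\<sigma><?Q. res \<sigma> - strategy n t \<sigma> r res =
        neighbours n w (strategy n t \<sigma> r res)) \<longrightarrow> spanning_forest n (edges n w) (out r res))}"
    let ?G' = "{r. r < (2 ^ (n * (t + 2))) ^ m \<and> components n (grow n w t r m) = components n (edges n w)}"
    have L: "(2::nat) ^ ?L = (2 ^ (n * (t + 2))) ^ m" by (simp add: power_mult)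
    have "?G' \<subseteq> ?G"
    proof clarify
      fix r assume r: "r < (2 ^ (n * (t + 2))) ^ m" "components n (grow n w t r m) = components n (edges n w)"
      have "spanning_forest n (edges n w) (out r res)"
        if "\<forall>\<sigma><?Q. res \<sigma> - strategy n t \<sigma> r res = neighbours n w (strategy n t \<sigma> r res)" for res
      proof -
        have g: "gather n t r res m = grow n w t r m"
          using that by (intro gather_eq_grow[OF _ n(2) t]) auto
        have fin: "finite (grow n w t r m)" using finite_edges grow_subset by (rule finite_subset[rotated])
        have "spanning_forest n (grow n w t r m) (out r res)"
          unfolding out_def g by (rule someI_ex[OF exists_spanning_forest[OF fin]])
        then have "out r res \<subseteq> grow n w t r m" "undirected_forest (out r res)"
          "components n (out r res) = components n (grow n w t r m)"
          unfolding spanning_forest_def by blast+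
        then show ?thesis using r(2) grow_subset[of n w t r m]
          unfolding spanning_forest_def by (metis subset_trans)
      qed
      then show "r < 2 ^ ?L \<and> (\<forall>res. (\<forall>\<sigma><?Q. res \<sigma> - strategy n t \<sigma> r res =
        neighbours n w (strategy n t \<sigma> r res)) \<longrightarrow> spanning_forest n (edges n w) (out r res))"
        using r(1) L by simp
    qed
    then have "card ?G' \<le> card ?G" by (intro card_mono) auto
    then have le: "real (card ?G') \<le> real (card ?G)" by simp
    have "49 / 50 * real ((2 ^ (n * (t + 2))) ^ m) \<le> real (card ?G')"
      unfolding m_def by (rule grow_success[OF n(2)])
    then have "49 / 50 * 2 ^ ?L \<le> real (card ?G)" using le arg_cong[OF L, of real] by simp
    then have "49 / 50 \<le> real (card ?G) / 2 ^ ?L" by (simp add: field_simps)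
    also have "\<dots> \<le> output_prob n M A w (spanning_forest n (edges n w))" by (rule A(3)[OF w])
    finally show "49 / 50 \<le> output_prob n M A w (spanning_forest n (edges n w))" .
  qed
qed

section \<open>The query count\<close>

lemma exists_power_of_two_bound:
  assumes "2 \<le> (k::nat)"
  obtains t where "0 < t" "k \<le> 2 ^ t" "real t \<le> 2 * log 2 (real k)"
proof
  let ?t = "nat \<lceil>log 2 (real k)\<rceil>"
  have l: "1 \<le> log 2 (real k)" using assms by (simp add: le_log_iff)
  then show "0 < ?t" by linarith
  have t: "real ?t = of_int \<lceil>log 2 (real k)\<rceil>" using l by simp
  then have "log 2 (real k) \<le> real ?t" by linarith
  then have "2 powr log 2 (real k) \<le> 2 powr real ?t" by (intro powr_mono) auto
  then have "real k \<le> 2 powr real ?t" using assms by simp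
  also have "\<dots> = real (2 ^ ?t)" by (subst powr_realpow) auto
  finally have "real k \<le> real (2 ^ ?t)" .
  then show "k \<le> 2 ^ ?t" by (simp only: of_nat_le_iff)
  show "real ?t \<le> 2 * log 2 (real k)" using t l by linarith
qed

theorem theorem12:
  shows "\<exists>C::real. \<forall>n M. 1 \<le> n \<longrightarrow> 1 \<le> M \<longrightarrow>
    (\<exists>A :: nat set set quantum_algorithm.
       valid_algorithm n M A \<and>
       real (num_queries A) \<le> C * log 2 (real n) ^ 4 * log 2 (real (M * n)) \<and>
       (\<forall>w \<in> weight_functions n M.
          49 / 50 \<le> output_prob n M A w (spanning_forest n (edges n w))))"
proof (intro exI[of _ 15360] allI impI)
  fix n M :: nat assume n: "1 \<le> n" and M: "1 \<le> M"
  show "\<exists>A :: nat set set quantum_algorithm.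
       valid_algorithm n M A \<and>
       real (num_queries A) \<le> 15360 * log 2 (real n) ^ 4 * log 2 (real (M * n)) \<and>
       (\<forall>w \<in> weight_functions n M. 49 / 50 \<le> output_prob n M A w (spanning_forest n (edges n w)))"
  proof (cases "n = 1")
    case True
    \<comment> \<open>Here \<open>log 2 n = 0\<close> forbids any query, so a run with no questions
      is used; without edges the empty forest is right.\<close>
    have "n * M \<le> 2 ^ M" using True less_exp[of M] by simp
    then obtain A :: "nat set set quantum_algorithm" where A: "valid_algorithm n M A" "num_queries A = 4 * (0 * M)"
      "\<And>w P. w \<in> weight_functions n M \<Longrightarrow>
      real (card {r::nat. r < 2 ^ 0 \<and> (\<forall>res :: nat \<Rightarrow> nat set. (\<forall>\<sigma><0. res \<sigma> - {} = neighbours n w {}) \<longrightarrow> P {})})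
      / 2 ^ 0 \<le> output_prob n M A w P"
      using adaptive_neighbour_tests[of n M M "\<lambda>_ _ _. {}" 0 0 "\<lambda>_ _. {}"] n M by auto
    have "spanning_forest n (edges n w) {}" for w
    proof -
      have "e \<notin> vertex_pairs n" for e
        using card_mono[of "{..<n}" e] True by (auto simp: vertex_pairs_def)
      then have "edges n w = {}" by (simp add: edges_def)
      then show ?thesis using exists_spanning_forest[of "{}" n] by (auto simp: spanning_forest_def)
    qed
    then have "1 \<le> output_prob n M A w (spanning_forest n (edges n w))" if "w \<in> weight_functions n M" for w
      using A(3)[OF that, of "spanning_forest n (edges n w)"] by simp
    then have "49 / 50 \<le> output_prob n M A w (spanning_forest n (edges n w))" if "w \<in> weight_functions n M" for w
      using that by fastforce
    then show ?thesis using A(1,2) True by (intro exI[of _ A]) simp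
  next
    case False
    then have n2: "2 \<le> n" using n by simp
    then have nM: "2 \<le> n * M" using M mult_le_mono[of 2 n 1 M] by simp
    obtain t where t: "0 < t" "n \<le> 2 ^ t" "real t \<le> 2 * log 2 (real n)"
      by (rule exists_power_of_two_bound[OF n2])
    obtain J where J: "n * M \<le> 2 ^ J" "real J \<le> 2 * log 2 (real (n * M))"
      by (rule exists_power_of_two_bound[OF nM])
    obtain A :: "nat set set quantum_algorithm" where A: "valid_algorithm n M A"
      "num_queries A = 4 * (15 * (t + 6) * ((t + 2) * (2 * t)) * J)"
      "\<And>w. w \<in> weight_functions n M \<Longrightarrow> 49 / 50 \<le> output_prob n M A w (spanning_forest n (edges n w))"
      using spanning_forest_algorithm[OF _ t(2,1) _ J(1)] n M by auto
    define l where "l = log 2 (real n)"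
    have l: "1 \<le> l" using n2 by (simp add: l_def le_log_iff)
    have "real (num_queries A) = 120 * (real t + 6) * (real t + 2) * real t * real J"
      unfolding A(2) by (simp add: algebra_simps)
    \<comment> \<open>For \<open>l >= 1\<close> the bound \<open>t <= 2 l\<close> gives
      \<open>t + 6 <= 8 l\<close> and \<open>t + 2 <= 4 l\<close>, whence 15360 = 120 * 8 * 4 * 2 *
      2.\<close>
    also have "\<dots> \<le> 120 * (8 * l) * (4 * l) * (2 * l) * (2 * log 2 (real (n * M)))"
      using t(3) J(2) l by (intro mult_mono) (auto simp: l_def)
    also have "\<dots> = 15360 * (l ^ 3 * 1) * log 2 (real (n * M))"
      by (simp add: power3_eq_cube)
    also have "\<dots> \<le> 15360 * (l ^ 3 * l) * log 2 (real (n * M))"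
    proof -
      have "0 \<le> log 2 (real (n * M))" using J(2) of_nat_0_le_iff[of J, where 'a=real] by linarith
      moreover have "15360 * (l ^ 3 * 1) \<le> 15360 * (l ^ 3 * l)" using l by simp
      ultimately show ?thesis by (rule mult_right_mono[rotated])
    qed
    also have "l ^ 3 * l = l ^ 4" by (simp add: eval_nat_numeral)
    finally show ?thesis
      using A(1,3) by (intro exI[of _ A]) (simp add: l_def mult.commute)
  qed
qed

end
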